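(* Suppose that every $B\in\mathcal B$ is bounded in $X$, $\Lambda$ is unbounded, $\phi:[0,\infty)\to[0,\infty)$ is monotonically increasing with $\phi(u+v)\le\phi(u)+\phi(v)$ for all $u,v\ge0$, $\limsup_{t\to+\infty}\omega(t)=0$, and there is $t_0>0$ with $\omega(t)\le([1]_{L^{p(\cdot)}(\Lambda_t)})^{-1}$ for $t\ge t_0$. For $B\in\mathcal B$ and $F,G\in e-(\mathcal B,\phi,\omega)-B^{p(\cdot)}(\Lambda\times X:Y)$ put $$d_B(F,G):=\limsup_{t\to+\infty}\omega(t)\sup_{x\in B}\big[\phi(\|F(\cdot;x)-G(\cdot;x)\|_Y)\big]_{L^{p(\cdot)}(\Lambda_t)}.$$ Then for every $B\in\mathcal B$, $d_B$ is a pseudometric on $e-(\mathcal B,\phi,\omega)-B^{p(\cdot)}(\Lambda\times X:Y)$ and this pseudometric space is complete: every $d_B$-Cauchy sequence in the class has a $d_B$-limit in the class.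
   Context: $X,Y$ are complex Banach spaces, $n\in\mathbb N$, $\emptyset\ne\Lambda\subseteq\mathbb R^n$ is Lebesgue measurable, $\mathcal B$ is a nonempty collection of nonempty subsets of $X$ whose union is $X$. For $t>0$, $\Lambda_t:=\Lambda\cap[-t,t]^n$. $p:\Lambda\to[1,\infty]$ is a measurable exponent, $\omega:(0,\infty)\to(0,\infty)$. For measurable $\Omega$ and measurable $g:\Omega\to[0,\infty]$, $[g]_{L^{p(\cdot)}(\Omega)}:=\inf\{\lambda>0:\int_\Omega\varphi_{p(x)}(g(x)/\lambda)\,dx\le1\}$ ($\inf\emptyset=+\infty$), where $\varphi_{p(x)}(s)=s^{p(x)}$ if $p(x)<\infty$, while for $p(x)=\infty$, $\varphi_{p(x)}(s)=0$ for $s\le1$ and $=\infty$ for $s>1$. A trigonometric polynomial is a finite sum $P(\mathbf t;x)=\sum_{l}e^{i\langle\lambda_l,\mathbf t\rangle}c_l(x)$ with $\lambda_l\in\mathbb R^n$ and $c_l:X\to Y$ continuous and bounded on bounded subsets of $X$. A function $F:\Lambda\times X\to Y$ (with each $F(\cdot;x)$ measurable) belongs to $e-(\mathcal B,\phi,\omega)-B^{p(\cdot)}(\Lambda\times X:Y)$ iff for each $B\in\mathcal B$ there is a sequence $(P_k)$ of trigonometric polynomials with $\lim_{k\to\infty}\limsup_{t\to\infty}\omega(t)\sup_{x\in B}\big[\phi(\|F(\cdot;x)-P_k(\cdot;x)\|_Y)\big]_{L^{p(\cdot)}(\Lambda_t)}=0$. *)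

theory Defs
  imports "HOL-Analysis.Analysis"
begin

class scaleC = scaleR +
  fixes scaleC :: "complex \<Rightarrow> 'a \<Rightarrow> 'a" (infixr \<open>*\<^sub>C\<close> 75)
  assumes scaleR_scaleC: "scaleR r = scaleC (complex_of_real r)"

class complex_vector = scaleC + ab_group_add +
  assumes scaleC_add_right: "a *\<^sub>C (x + y) = a *\<^sub>C x + a *\<^sub>C y"
    and scaleC_add_left: "(a + b) *\<^sub>C x = a *\<^sub>C x + b *\<^sub>C x"
    and scaleC_scaleC: "a *\<^sub>C (b *\<^sub>C x) = (a * b) *\<^sub>C x"
    and scaleC_one: "1 *\<^sub>C x = x"

class complex_normed_vector = complex_vector + real_normed_vector +
  assumes norm_scaleC: "norm (a *\<^sub>C x) = cmod a * norm x"

text \<open>The modular function phi_{p(x)}; the exponent p takes values in [1,infinity],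
  represented in ennreal (top = infinity). Arguments s are nonnegative reals.\<close>
definition phi_exp :: "ennreal \<Rightarrow> real \<Rightarrow> ennreal" where
  "phi_exp q s = (if q = top then (if s \<le> 1 then 0 else top) else ennreal (s powr enn2real q))"

text \<open>[g]_{L^{p(.)}(Omega)} = inf of lambda > 0 with modular <= 1; inf of empty set = top.\<close>
definition luxnorm :: "('n::euclidean_space \<Rightarrow> ennreal) \<Rightarrow> 'n set \<Rightarrow> ('n \<Rightarrow> real) \<Rightarrow> ennreal" where
  "luxnorm p \<Omega> g = Inf {ennreal l | l. l > 0 \<and>
      (\<integral>\<^sup>+ x. phi_exp (p x) (g x / l) * indicator \<Omega> x \<partial>lebesgue) \<le> 1}"

definition Lam_t :: "(real ^ 'n) set \<Rightarrow> real \<Rightarrow> (real ^ 'n) set" where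
  "Lam_t \<Lambda> t = \<Lambda> \<inter> {v. \<forall>i. \<bar>v $ i\<bar> \<le> t}"

definition trig_poly :: "(real ^ 'n \<Rightarrow> 'x::real_normed_vector \<Rightarrow> 'y::complex_normed_vector) \<Rightarrow> bool" where
  "trig_poly P \<longleftrightarrow> (\<exists>(L::nat) (lam :: nat \<Rightarrow> real ^ 'n) (c :: nat \<Rightarrow> 'x \<Rightarrow> 'y).
      (\<forall>l<L. continuous_on UNIV (c l) \<and> (\<forall>S. bounded S \<longrightarrow> bounded (c l ` S))) \<and>
      P = (\<lambda>t x. \<Sum>l<L. exp (\<i> * complex_of_real (lam l \<bullet> t)) *\<^sub>C c l x))"

definition dist_B ::
  "(real \<Rightarrow> real) \<Rightarrow> (real \<Rightarrow> real) \<Rightarrow> (real ^ 'n \<Rightarrow> ennreal) \<Rightarrow> (real ^ 'n) set \<Rightarrow> 'x set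
    \<Rightarrow> (real ^ 'n \<Rightarrow> 'x \<Rightarrow> 'y::real_normed_vector) \<Rightarrow> (real ^ 'n \<Rightarrow> 'x \<Rightarrow> 'y) \<Rightarrow> ennreal" where
  "dist_B \<phi> \<omega> p \<Lambda> B F G = Limsup at_top (\<lambda>t. ennreal (\<omega> t) *
      (SUP x\<in>B. luxnorm p (Lam_t \<Lambda> t) (\<lambda>s. \<phi> (norm (F s x - G s x)))))"

definition e_Besicovitch ::
  "'x set set \<Rightarrow> (real \<Rightarrow> real) \<Rightarrow> (real \<Rightarrow> real) \<Rightarrow> (real ^ 'n \<Rightarrow> ennreal) \<Rightarrow> (real ^ 'n) set
    \<Rightarrow> (real ^ 'n \<Rightarrow> 'x::real_normed_vector \<Rightarrow> 'y::complex_normed_vector) set" where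
  "e_Besicovitch \<B> \<phi> \<omega> p \<Lambda> = {F.
      (\<forall>x. (\<lambda>t. F t x) \<in> borel_measurable (restrict_space lebesgue \<Lambda>)) \<and>
      (\<forall>B\<in>\<B>. \<exists>P :: nat \<Rightarrow> real ^ 'n \<Rightarrow> 'x \<Rightarrow> 'y. (\<forall>k. trig_poly (P k)) \<and>
         ((\<lambda>k. dist_B \<phi> \<omega> p \<Lambda> B F (P k)) \<longlonglongrightarrow> 0))}"

definition pseudometric_on :: "'a set \<Rightarrow> ('a \<Rightarrow> 'a \<Rightarrow> ennreal) \<Rightarrow> bool" where
  "pseudometric_on A d \<longleftrightarrow>
     (\<forall>x\<in>A. \<forall>y\<in>A. d x y < top) \<and>
     (\<forall>x\<in>A. d x x = 0) \<and>
     (\<forall>x\<in>A. \<forall>y\<in>A. d x y = d y x) \<and>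
     (\<forall>x\<in>A. \<forall>y\<in>A. \<forall>z\<in>A. d x z \<le> d x y + d y z)"

definition complete_pseudometric_on :: "'a set \<Rightarrow> ('a \<Rightarrow> 'a \<Rightarrow> ennreal) \<Rightarrow> bool" where
  "complete_pseudometric_on A d \<longleftrightarrow>
     (\<forall>f :: nat \<Rightarrow> 'a. (\<forall>k. f k \<in> A) \<longrightarrow>
        (\<forall>e>0. \<exists>N. \<forall>m\<ge>N. \<forall>n\<ge>N. d (f m) (f n) < ennreal e) \<longrightarrow>
        (\<exists>g\<in>A. (\<lambda>k. d (f k) g) \<longlonglongrightarrow> 0))"

end

theory Submission
  imports Defs
begin

text \<open>Measurability: \<open>Y\<close> need not be separable, so \<open>\<parallel>F - G\<parallel>\<close> may be non-measurable and the integral, a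
  lower integral, need not be subadditive. It is measurable if \<open>F\<close> or \<open>G\<close> is a trigonometric polynomial,
  and since members of the class are limits of such polynomials, the triangle inequality survives.
  The class is nonempty only if \<open>d\<^sub>B(0, 0) = 0\<close>, which replaces the missing hypothesis \<open>\<phi> 0 = 0\<close>.

  Completeness: a \<open>d\<^sub>B\<close>-limit must be approximable on all members of \<open>\<B>\<close>, not only on \<open>B\<close>. Replace a
  Cauchy sequence by trigonometric polynomials \<open>P\<^sub>k\<close> with \<open>d\<^sub>B(P\<^sub>k, P\<^sub>k\<^sub>+\<^sub>1)\<close> summable. If \<open>\<phi>(0+) = 0\<close>, multiply
  the coefficients of \<open>P\<^sub>k\<^sub>+\<^sub>1 - P\<^sub>k\<close> by a cutoff function of \<open>x\<close> that is \<open>1\<close> on \<open>B\<close> and vanishes where the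
  coefficients are far from their values on \<open>B\<close>; this keeps the differences on \<open>B\<close> and makes them bounded and
  small uniformly in \<open>x \<in> X\<close>. If \<open>\<phi>(0+) > 0\<close>, then, since the zero set of a nonzero trigonometric
  polynomial is negligible, either \<open>d\<^sub>B\<close> vanishes or \<open>P\<^sub>k = P\<^sub>k\<^sub>+\<^sub>1\<close> on \<open>B\<close> eventually. The modified
  polynomials are Cauchy uniformly in \<open>x \<in> X\<close>, and gluing them along rapidly growing cubical shells, as in
  the completeness proof for Marcinkiewicz spaces, yields the limit, because \<open>\<omega>(t) \<rightarrow> 0\<close>.\<close>

section \<open>Luxemburg norms\<close>

lemma Limsup_add_le_ennreal:
  fixes f g :: "'a \<Rightarrow> ennreal"
  shows "Limsup F (\<lambda>x. f x + g x) \<le> Limsup F f + Limsup F g"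
proof (rule ennreal_le_epsilon)
  fix e :: real
  assume fin: "Limsup F f + Limsup F g < top" and "0 < e"
  then have f: "Limsup F f < Limsup F f + ennreal (e/2)" and g: "Limsup F g < Limsup F g + ennreal (e/2)"
    by (auto simp: ennreal_add_less_top less_top[symmetric] ennreal_less_zero_iff
        intro!: ennreal_add_left_cancel_less[THEN iffD2, of _ 0, simplified])
  have e: "ennreal (e/2) + ennreal (e/2) = ennreal e"
    using \<open>0 < e\<close> by (simp flip: ennreal_plus)
  show "Limsup F (\<lambda>x. f x + g x) \<le> Limsup F f + Limsup F g + ennreal e"
  proof (rule Limsup_bounded, use Limsup_lessD[OF f] Limsup_lessD[OF g] in eventually_elim)
    case (elim x)
    then have "f x + g x \<le> (Limsup F f + ennreal (e/2)) + (Limsup F g + ennreal (e/2))"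
      by (intro add_mono) auto
    also have "\<dots> = Limsup F f + Limsup F g + ennreal e"
      unfolding e[symmetric] by (simp add: ac_simps)
    finally show ?case .
  qed
qed

lemma phi_exp_0 [simp]: "phi_exp q 0 = 0"
  by (simp add: phi_exp_def)

lemma phi_exp_mono:
  assumes "0 \<le> s" "s \<le> t"
  shows "phi_exp q s \<le> phi_exp q t"
  using assms by (auto simp: phi_exp_def intro!: ennreal_leI powr_mono2)

lemma powr_convex_combination:
  fixes a b \<theta> q :: real
  assumes "1 \<le> q" "0 \<le> a" "0 \<le> b" "0 \<le> \<theta>" "\<theta> \<le> 1"
  shows "(\<theta> * a + (1 - \<theta>) * b) powr q \<le> \<theta> * a powr q + (1 - \<theta>) * b powr q"
proof -
  have scale: "(c * s) powr q \<le> c * s powr q" if "0 \<le> c" "c \<le> 1" "0 \<le> s" for c s :: real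
  proof -
    have "c powr q \<le> c powr 1"
      using that \<open>1 \<le> q\<close> powr_mono'[of 1 q c] by (cases "c = 0") auto
    then show ?thesis
      using that by (auto simp: powr_mult intro!: mult_right_mono)
  qed
  show ?thesis
  proof (cases "a = 0 \<or> b = 0")
    case True
    then show ?thesis
      using scale[of "1 - \<theta>" b] scale[of \<theta> a] assms by auto
  next
    case False
    then show ?thesis
      using convex_onD[OF powr_convex[OF assms(1)], of \<theta> b a] assms by (simp add: add.commute)
  qed
qed

lemma phi_exp_convex:
  assumes "1 \<le> q" "0 \<le> a" "0 \<le> b" "0 < \<theta>" "\<theta> < 1"
  shows "phi_exp q (\<theta> * a + (1 - \<theta>) * b) \<le> ennreal \<theta> * phi_exp q a + ennreal (1 - \<theta>) * phi_exp q b"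
proof (cases "q = top")
  case True
  show ?thesis
  proof (cases "a \<le> 1 \<and> b \<le> 1")
    case le: True
    then have "\<theta> * a + (1 - \<theta>) * b \<le> \<theta> * 1 + (1 - \<theta>) * 1"
      using assms by (intro add_mono mult_left_mono) auto
    then show ?thesis using True by (simp add: phi_exp_def)
  next
    case False
    then show ?thesis using True assms by (auto simp: phi_exp_def ennreal_mult_top)
  qed
next
  case False
  then obtain r where r: "q = ennreal r" "0 \<le> r" by (cases q) auto
  then have "1 \<le> r" using assms by simp
  then have "(\<theta> * a + (1 - \<theta>) * b) powr r \<le> \<theta> * a powr r + (1 - \<theta>) * b powr r"
    using assms by (intro powr_convex_combination) auto
  then have "ennreal ((\<theta> * a + (1 - \<theta>) * b) powr r) \<le> ennreal (\<theta> * a powr r + (1 - \<theta>) * b powr r)"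
    by (rule ennreal_leI)
  also have "\<dots> = ennreal \<theta> * ennreal (a powr r) + ennreal (1 - \<theta>) * ennreal (b powr r)"
    using assms by (simp add: ennreal_mult)
  finally show ?thesis using r by (simp add: phi_exp_def)
qed

lemma measurable_phi_exp [measurable (raw)]:
  assumes [measurable]: "p \<in> borel_measurable M" "u \<in> borel_measurable M"
  shows "(\<lambda>x. phi_exp (p x) (u x)) \<in> borel_measurable M"
  unfolding phi_exp_def by measurable

lemma luxnorm_le:
  assumes "0 < l" "(\<integral>\<^sup>+ x. phi_exp (p x) (u x / l) * indicator \<Omega> x \<partial>lebesgue) \<le> 1"
  shows "luxnorm p \<Omega> u \<le> ennreal l"
  unfolding luxnorm_def using assms by (auto intro: Inf_lower)

lemma luxnorm_lessE:
  assumes "luxnorm p \<Omega> u < ennreal c"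
  obtains l where "0 < l" "l < c" "(\<integral>\<^sup>+ x. phi_exp (p x) (u x / l) * indicator \<Omega> x \<partial>lebesgue) \<le> 1"
  using assms unfolding luxnorm_def by (auto simp: Inf_less_iff ennreal_less_iff)

lemma luxnorm_mono_AE:
  assumes "\<Omega> \<subseteq> \<Omega>'" "AE x in lebesgue. x \<in> \<Omega> \<longrightarrow> 0 \<le> u x \<and> u x \<le> v x"
  shows "luxnorm p \<Omega> u \<le> luxnorm p \<Omega>' v"
  unfolding luxnorm_def
proof (rule Inf_mono, clarify)
  fix l :: real
  assume l: "0 < l" and v: "(\<integral>\<^sup>+ x. phi_exp (p x) (v x / l) * indicator \<Omega>' x \<partial>lebesgue) \<le> 1"
  have "(\<integral>\<^sup>+ x. phi_exp (p x) (u x / l) * indicator \<Omega> x \<partial>lebesgue)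
      \<le> (\<integral>\<^sup>+ x. phi_exp (p x) (v x / l) * indicator \<Omega>' x \<partial>lebesgue)"
  proof (rule nn_integral_mono_AE, use assms(2) in eventually_elim)
    case (elim x)
    then show ?case
      using \<open>\<Omega> \<subseteq> \<Omega>'\<close> l
      by (auto simp: indicator_def intro!: phi_exp_mono divide_right_mono)
  qed
  also note v
  finally show "\<exists>a\<in>{ennreal l |l. 0 < l \<and>
      (\<integral>\<^sup>+ x. phi_exp (p x) (u x / l) * indicator \<Omega> x \<partial>lebesgue) \<le> 1}. a \<le> ennreal l"
    using l by auto
qed

lemma luxnorm_mono:
  assumes "\<And>x. x \<in> \<Omega> \<Longrightarrow> 0 \<le> u x" "\<And>x. x \<in> \<Omega> \<Longrightarrow> u x \<le> v x"
  shows "luxnorm p \<Omega> u \<le> luxnorm p \<Omega> v"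
  using assms by (intro luxnorm_mono_AE) auto

lemma luxnorm_indicator:
  "luxnorm p \<Omega> (\<lambda>x. c * indicator S x) = luxnorm p (\<Omega> \<inter> S) (\<lambda>_. c)"
proof -
  have "phi_exp (p x) (c * indicator S x / l) * indicator \<Omega> x
      = phi_exp (p x) (c / l) * indicator (\<Omega> \<inter> S) x" for x and l :: real
    by (auto simp: indicator_def)
  then show ?thesis unfolding luxnorm_def by simp
qed

lemma luxnorm_cmult_le:
  assumes "0 \<le> c"
  shows "luxnorm p \<Omega> (\<lambda>x. c * u x) \<le> ennreal c * luxnorm p \<Omega> u"
proof (cases "c = 0")
  case True
  have "luxnorm p \<Omega> (\<lambda>x. 0) \<le> 0"
    by (rule ennreal_le_epsilon) (auto intro!: luxnorm_le)
  then show ?thesis using True by simp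
next
  case False
  then have c: "0 < c" using assms by simp
  have "ennreal (1 / c) * luxnorm p \<Omega> (\<lambda>x. c * u x) \<le> luxnorm p \<Omega> u"
    unfolding luxnorm_def[of p \<Omega> u]
  proof (rule Inf_greatest, clarify)
    fix l :: real
    assume l: "0 < l" "(\<integral>\<^sup>+ x. phi_exp (p x) (u x / l) * indicator \<Omega> x \<partial>lebesgue) \<le> 1"
    then have "luxnorm p \<Omega> (\<lambda>x. c * u x) \<le> ennreal (c * l)"
      using c by (intro luxnorm_le) auto
    then have "ennreal (1 / c) * luxnorm p \<Omega> (\<lambda>x. c * u x) \<le> ennreal (1 / c) * ennreal (c * l)"
      by (rule mult_left_mono) simp
    also have "\<dots> = ennreal l"
      using c l by (simp flip: ennreal_mult)
    finally show "ennreal (1 / c) * luxnorm p \<Omega> (\<lambda>x. c * u x) \<le> ennreal l" .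
  qed
  then have "ennreal c * (ennreal (1 / c) * luxnorm p \<Omega> (\<lambda>x. c * u x)) \<le> ennreal c * luxnorm p \<Omega> u"
    by (rule mult_left_mono) simp
  moreover have "ennreal c * (ennreal (1 / c) * luxnorm p \<Omega> (\<lambda>x. c * u x)) = luxnorm p \<Omega> (\<lambda>x. c * u x)"
    using c by (simp add: mult.assoc[symmetric] flip: ennreal_mult)
  ultimately show ?thesis by simp
qed

lemma luxnorm_const_le:
  assumes "0 \<le> c"
  shows "luxnorm p \<Omega> (\<lambda>_. c) \<le> ennreal c * luxnorm p \<Omega> (\<lambda>_. 1)"
  using luxnorm_cmult_le[OF assms, of p \<Omega> "\<lambda>_. 1"] by simp

lemma luxnorm_add:
  fixes p :: "'a::euclidean_space \<Rightarrow> ennreal"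
  assumes \<Omega>: "\<Omega> \<in> sets lebesgue" and p1: "\<And>x. x \<in> \<Omega> \<Longrightarrow> 1 \<le> p x"
    and [measurable]: "p \<in> borel_measurable (restrict_space lebesgue \<Omega>)"
      "u \<in> borel_measurable (restrict_space lebesgue \<Omega>)"
      "v \<in> borel_measurable (restrict_space lebesgue \<Omega>)"
    and u0: "\<And>x. x \<in> \<Omega> \<Longrightarrow> 0 \<le> u x" and v0: "\<And>x. x \<in> \<Omega> \<Longrightarrow> 0 \<le> v x"
  shows "luxnorm p \<Omega> (\<lambda>x. u x + v x) \<le> luxnorm p \<Omega> u + luxnorm p \<Omega> v"
proof (rule ennreal_le_epsilon)
  fix e :: real
  assume fin: "luxnorm p \<Omega> u + luxnorm p \<Omega> v < top" and e: "0 < e"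
  obtain a b where a: "luxnorm p \<Omega> u = ennreal a" "0 \<le> a" and b: "luxnorm p \<Omega> v = ennreal b" "0 \<le> b"
    using fin by (cases "luxnorm p \<Omega> u"; cases "luxnorm p \<Omega> v") auto
  have "luxnorm p \<Omega> u < ennreal (a + e/2)" "luxnorm p \<Omega> v < ennreal (b + e/2)"
    using a b e by (auto simp: ennreal_less_iff)
  then obtain l m where l: "0 < l" "l < a + e/2"
      and lu: "(\<integral>\<^sup>+ x. phi_exp (p x) (u x / l) * indicator \<Omega> x \<partial>lebesgue) \<le> 1"
    and m: "0 < m" "m < b + e/2"
      and mv: "(\<integral>\<^sup>+ x. phi_exp (p x) (v x / m) * indicator \<Omega> x \<partial>lebesgue) \<le> 1"
    by (elim luxnorm_lessE)
  define \<theta> where "\<theta> = l / (l + m)"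
  have \<theta>: "0 < \<theta>" "\<theta> < 1" "\<theta> / l = 1 / (l + m)" "(1 - \<theta>) / m = 1 / (l + m)"
    using l m unfolding \<theta>_def by (simp_all add: diff_divide_eq_iff[of "l + m"] add_pos_pos)
  have eq: "(u x + v x) / (l + m) = \<theta> * (u x / l) + (1 - \<theta>) * (v x / m)" for x
  proof -
    have "\<theta> * (u x / l) + (1 - \<theta>) * (v x / m) = (\<theta> / l) * u x + ((1 - \<theta>) / m) * v x"
      by simp
    also have "\<dots> = (u x + v x) / (l + m)"
      unfolding \<theta> by (simp add: add_divide_distrib)
    finally show ?thesis by simp
  qed
  have meas: "(\<lambda>x. phi_exp (p x) (w x) * indicator \<Omega> x) \<in> borel_measurable lebesgue"
    if [measurable]: "w \<in> borel_measurable (restrict_space lebesgue \<Omega>)" for w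
    using \<Omega> by (subst borel_measurable_restrict_space_iff_ennreal[symmetric]) auto
  note [measurable] = meas[of "\<lambda>x. u x / l", simplified] meas[of "\<lambda>x. v x / m", simplified]
  have "(\<integral>\<^sup>+ x. phi_exp (p x) ((u x + v x) / (l + m)) * indicator \<Omega> x \<partial>lebesgue)
     \<le> (\<integral>\<^sup>+ x. ennreal \<theta> * (phi_exp (p x) (u x / l) * indicator \<Omega> x)
            + ennreal (1 - \<theta>) * (phi_exp (p x) (v x / m) * indicator \<Omega> x) \<partial>lebesgue)"
    unfolding eq
  proof (intro nn_integral_mono)
    fix x
    have "phi_exp (p x) (\<theta> * (u x / l) + (1 - \<theta>) * (v x / m))
        \<le> ennreal \<theta> * phi_exp (p x) (u x / l) + ennreal (1 - \<theta>) * phi_exp (p x) (v x / m)" if "x \<in> \<Omega>"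
      using that \<theta> l m p1 u0 v0 by (intro phi_exp_convex) auto
    then show "phi_exp (p x) (\<theta> * (u x / l) + (1 - \<theta>) * (v x / m)) * indicator \<Omega> x
        \<le> ennreal \<theta> * (phi_exp (p x) (u x / l) * indicator \<Omega> x)
            + ennreal (1 - \<theta>) * (phi_exp (p x) (v x / m) * indicator \<Omega> x)"
      by (cases "x \<in> \<Omega>") simp_all
  qed
  also have "\<dots> = ennreal \<theta> * (\<integral>\<^sup>+ x. phi_exp (p x) (u x / l) * indicator \<Omega> x \<partial>lebesgue)
      + ennreal (1 - \<theta>) * (\<integral>\<^sup>+ x. phi_exp (p x) (v x / m) * indicator \<Omega> x \<partial>lebesgue)"
    by (subst nn_integral_add; (subst nn_integral_cmult)?; simp?) (simp_all add: nn_integral_cmult)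
  also have "\<dots> \<le> ennreal \<theta> * 1 + ennreal (1 - \<theta>) * 1"
    using lu mv by (intro add_mono mult_left_mono) auto
  also have "\<dots> = 1"
    using \<theta> by (simp flip: ennreal_plus)
  finally have "luxnorm p \<Omega> (\<lambda>x. u x + v x) \<le> ennreal (l + m)"
    using l m by (intro luxnorm_le) auto
  also have "\<dots> \<le> ennreal (a + b + e)"
    using l m by (intro ennreal_leI) auto
  also have "\<dots> = luxnorm p \<Omega> u + luxnorm p \<Omega> v + ennreal e"
    using a b e by simp
  finally show "luxnorm p \<Omega> (\<lambda>x. u x + v x) \<le> luxnorm p \<Omega> u + luxnorm p \<Omega> v + ennreal e" .
qed

section \<open>Trigonometric polynomials\<close>

lemma scaleC_minus_left: "(- a) *\<^sub>C (x :: 'a::complex_vector) = - (a *\<^sub>C x)"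
  by (metis add.inverse_unique add.right_neutral add_left_cancel scaleC_add_left add.right_inverse)

lemma scaleC_diff_left: "(a - b) *\<^sub>C (x :: 'a::complex_vector) = a *\<^sub>C x - b *\<^sub>C x"
  using scaleC_add_left[of a "- b" x] by (simp add: scaleC_minus_left)

lemma scaleC_zero_left [simp]: "0 *\<^sub>C (x :: 'a::complex_vector) = 0"
  by (metis add_cancel_right_right scaleC_add_left)

lemma scaleC_zero_right [simp]: "a *\<^sub>C (0 :: 'a::complex_vector) = 0"
  by (metis add_cancel_right_right scaleC_add_right)

lemma scaleC_sum_right: "a *\<^sub>C (\<Sum>i\<in>I. f i) = (\<Sum>i\<in>I. a *\<^sub>C (f i :: 'a::complex_vector))"
  by (induction I rule: infinite_finite_induct) (auto simp: scaleC_add_right)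

lemma scaleC_scaleR_commute:
  "a *\<^sub>C (r *\<^sub>R x) = r *\<^sub>R (a *\<^sub>C (x :: 'a::complex_normed_vector))"
  by (simp add: scaleR_scaleC scaleC_scaleC mult.commute)

lemma scaleC_minus_right: "a *\<^sub>C (- x :: 'a::complex_normed_vector) = - (a *\<^sub>C x)"
  using scaleC_scaleR_commute[of a "-1" x] by simp

lemma scaleC_diff_right: "a *\<^sub>C (x - y :: 'a::complex_normed_vector) = a *\<^sub>C x - a *\<^sub>C y"
  using scaleC_add_right[of a x "- y"] by (simp add: scaleC_minus_right)

lemma scaleC_eq_0_iff: "a *\<^sub>C (x :: 'a::complex_normed_vector) = 0 \<longleftrightarrow> a = 0 \<or> x = 0"
  using norm_scaleC[of a x] by (metis mult_eq_0_iff norm_eq_zero)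

lemma continuous_on_scaleC_left:
  fixes c :: "'a::complex_normed_vector"
  assumes "continuous_on S f"
  shows "continuous_on S (\<lambda>t. f t *\<^sub>C c)"
proof -
  have "bounded_linear (\<lambda>a. a *\<^sub>C c)"
    by (rule bounded_linear_intro[where K = "norm c"])
       (auto simp: scaleC_add_left norm_scaleC scaleR_scaleC scaleC_scaleC scaleR_conv_of_real)
  then show ?thesis
    using assms by (rule bounded_linear.continuous_on)
qed

definition character :: "'a::real_inner \<Rightarrow> 'a \<Rightarrow> complex"
  where "character \<nu> t = exp (\<i> * complex_of_real (\<nu> \<bullet> t))"

lemma norm_character [simp]: "norm (character \<nu> t) = 1"
  by (simp add: character_def)

lemma character_nonzero [simp]: "character \<nu> t \<noteq> 0"
  by (simp add: character_def)

lemma character_add: "character \<nu> (t + h) = character \<nu> t * character \<nu> h"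
  by (simp add: character_def inner_add_right distrib_left exp_add)

lemma continuous_on_character [continuous_intros]: "continuous_on S (character \<nu>)"
  unfolding character_def by (intro continuous_intros)

lemma continuous_on_character_sum:
  "continuous_on S (\<lambda>t. \<Sum>i\<in>I. character (lam i) t *\<^sub>C (c i :: 'a::complex_normed_vector))"
  by (intro continuous_intros continuous_on_scaleC_left)

lemma character_neq:
  assumes "a \<noteq> b" "0 < r" "r < 2 * pi / ((a - b) \<bullet> (a - b))"
  shows "character a (r *\<^sub>R (a - b)) \<noteq> character b (r *\<^sub>R (a - b))"
proof
  assume "character a (r *\<^sub>R (a - b)) = character b (r *\<^sub>R (a - b))"
  then obtain n :: int where "\<i> * complex_of_real (a \<bullet> r *\<^sub>R (a - b))
      = \<i> * complex_of_real (b \<bullet> r *\<^sub>R (a - b)) + of_int (2 * n) * pi * \<i>"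
    unfolding character_def exp_eq by blast
  then have "\<i> * complex_of_real (a \<bullet> r *\<^sub>R (a - b))
      = \<i> * complex_of_real (b \<bullet> r *\<^sub>R (a - b) + of_int (2 * n) * pi)"
    by (simp add: algebra_simps)
  then have "a \<bullet> r *\<^sub>R (a - b) = b \<bullet> r *\<^sub>R (a - b) + of_int (2 * n) * pi"
    by (simp only: mult_cancel_left of_real_eq_iff) simp
  then have eq: "r * ((a - b) \<bullet> (a - b)) = of_int n * (2 * pi)"
    by (simp add: inner_diff_left algebra_simps)
  have pos: "0 < (a - b) \<bullet> (a - b)"
    using \<open>a \<noteq> b\<close> by simp
  have "0 < r * ((a - b) \<bullet> (a - b))" "r * ((a - b) \<bullet> (a - b)) < 1 * (2 * pi)"
    using assms pos by (simp_all add: pos_less_divide_eq)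
  then have "0 < of_int n * (2 * pi)" "of_int n * (2 * pi) < 1 * (2 * pi)"
    unfolding eq by blast+
  then have "0 < (of_int n :: real)" "of_int n < (1 :: real)"
    by (auto simp: zero_less_mult_iff mult_less_cancel_right_pos)
  then show False by simp
qed

text \<open>By pigeonhole: many small translates of a bounded piece of \<open>Z\<close> cannot be almost disjoint
  inside a fixed ball.\<close>

lemma ex_small_recurrent_translation:
  fixes Z :: "'a::euclidean_space set"
  assumes Z: "closed Z" "\<not> negligible Z" and "0 < \<delta>"
  obtains r where "0 < r" "r < \<delta>" "\<not> negligible {t \<in> Z. t + r *\<^sub>R v \<in> Z}"
proof -
  have "Z = (\<Union>n::nat. Z \<inter> cball 0 (real n))"
    using real_arch_simple by fastforce
  then obtain n :: nat where n: "\<not> negligible (Z \<inter> cball 0 (real n))"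
    using Z negligible_Union_nat[of "\<lambda>n. Z \<inter> cball 0 (real n)"] by force
  define W where "W = Z \<inter> cball 0 (real n)"
  have W: "W \<in> lmeasurable"
    unfolding W_def using \<open>closed Z\<close> by (intro lmeasurable_compact) (auto intro: closed_Int_compact)
  then have m: "0 < measure lebesgue W"
    using n W_def negligible_iff_measure0[OF W] zero_less_measure_iff by blast
  define C where "C = cball (0::'a) (real n + \<delta> * norm v)"
  have C: "C \<in> lmeasurable"
    unfolding C_def by (rule lmeasurable_cball)
  obtain N :: nat where N: "measure lebesgue C < real N * measure lebesgue W"
    using reals_Archimedean3[OF m] by blast
  then have "0 < N"
    by (metis measure_nonneg mult_zero_left not_gr_zero not_less of_nat_0)
  define h where "h j = (\<delta> * real j / real N) *\<^sub>R v" for j :: nat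
  have *: "\<exists>i j. i < j \<and> j < N \<and> \<not> negligible ((+) (h i) ` W \<inter> (+) (h j) ` W)"
  proof (rule ccontr)
    assume neg: "\<not> ?thesis"
    have "pairwise (\<lambda>i j. negligible ((+) (h i) ` W \<inter> (+) (h j) ` W)) {..<N}"
      unfolding pairwise_def using neg by (metis Int_commute lessThan_iff nat_neq_iff)
    then have "measure lebesgue (\<Union>j<N. (+) (h j) ` W) = (\<Sum>j<N. measure lebesgue ((+) (h j) ` W))"
      using W by (intro measure_negligible_finite_Union_image measurable_translation) auto
    also have "\<dots> = real N * measure lebesgue W"
      by (simp add: measure_translation)
    finally have "real N * measure lebesgue W = measure lebesgue (\<Union>j<N. (+) (h j) ` W)" ..
    also have "\<dots> \<le> measure lebesgue C"
    proof (rule measure_mono_fmeasurable[OF _ _ C])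
      show "(\<Union>j<N. (+) (h j) ` W) \<subseteq> C"
      proof clarify
        fix j w assume "j < N" "w \<in> W"
        have "\<delta> * real j / real N \<le> \<delta>"
          using \<open>0 < \<delta>\<close> \<open>j < N\<close> \<open>0 < N\<close> by (simp add: divide_le_eq)
        then have "\<delta> * real j / real N * norm v \<le> \<delta> * norm v"
          by (rule mult_right_mono) simp
        then have "norm (h j) \<le> \<delta> * norm v"
          using \<open>0 < \<delta>\<close> by (simp add: h_def)
        moreover have "norm w \<le> real n"
          using \<open>w \<in> W\<close> by (simp add: W_def)
        ultimately show "h j + w \<in> C"
          unfolding C_def using norm_triangle_ineq[of "h j" w] by simp
      qed
      show "(\<Union>j<N. (+) (h j) ` W) \<in> sets lebesgue"
        using W by (intro sets.finite_UN) (auto intro!: fmeasurableD measurable_translation)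
    qed
    finally show False using N by simp
  qed
  then obtain i j where ij: "i < j" "j < N" "\<not> negligible ((+) (h i) ` W \<inter> (+) (h j) ` W)"
    by blast
  define r where "r = \<delta> * real (j - i) / real N"
  have r: "0 < r" "r < \<delta>"
    using ij \<open>0 < \<delta>\<close> by (auto simp: r_def divide_less_eq)
  have hr: "h j = h i + r *\<^sub>R v"
    using \<open>i < j\<close> by (simp add: h_def r_def of_nat_diff algebra_simps diff_divide_distrib)
  have "(+) (h i) ` W \<inter> (+) (h j) ` W \<subseteq> (+) (h j) ` {t \<in> Z. t + r *\<^sub>R v \<in> Z}"
  proof clarify
    fix w w' assume w: "w \<in> W" "w' \<in> W" and eq: "h i + w = h j + w'"
    then have "w = w' + r *\<^sub>R v" by (simp add: hr)
    then have "w' \<in> {t \<in> Z. t + r *\<^sub>R v \<in> Z}"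
      using w by (simp add: W_def)
    then show "h i + w \<in> (+) (h j) ` {t \<in> Z. t + r *\<^sub>R v \<in> Z}"
      unfolding eq by (rule imageI)
  qed
  then have "\<not> negligible {t \<in> Z. t + r *\<^sub>R v \<in> Z}"
    using ij(3) negligible_subset negligible_translation by blast
  with r show ?thesis by (rule that)
qed

text \<open>Induction on the number of frequencies: subtracting \<open>character a h * f\<close> from the translate of
  \<open>f\<close> by \<open>h\<close> removes the frequency \<open>a\<close>, and for suitable small \<open>h\<close> the difference still vanishes on a
  non-negligible set.\<close>

lemma character_sum_zeros_not_negligible:
  fixes c :: "'a::euclidean_space \<Rightarrow> 'b::complex_normed_vector"
  assumes "finite S" "\<not> negligible {t. (\<Sum>\<nu>\<in>S. character \<nu> t *\<^sub>C c \<nu>) = 0}" "\<nu> \<in> S"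
  shows "c \<nu> = 0"
  using assms
proof (induction "card S" arbitrary: S c \<nu> rule: less_induct)
  case less
  let ?f = "\<lambda>S t. \<Sum>\<nu>\<in>S. character \<nu> t *\<^sub>C c \<nu>"
  let ?Z = "{t. ?f S t = 0}"
  show ?case
  proof (cases "\<exists>b\<in>S. b \<noteq> \<nu>")
    case False
    then have S: "S = {\<nu>}"
      using less.prems(3) by blast
    have "?Z \<noteq> {}"
      using less.prems(2) negligible_empty by metis
    then obtain t where "?f S t = 0"
      by blast
    then have "character \<nu> t *\<^sub>C c \<nu> = 0"
      unfolding S by simp
    then show ?thesis
      unfolding scaleC_eq_0_iff by simp
  next
    case True
    then obtain b where b: "b \<in> S" "b \<noteq> \<nu>" by blast
    have cl: "closed ?Z"
      by (intro closed_Collect_eq continuous_on_character_sum continuous_on_const)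
    have pos: "0 < 2 * pi / ((\<nu> - b) \<bullet> (\<nu> - b))"
      using b by simp
    obtain r where r: "0 < r" "r < 2 * pi / ((\<nu> - b) \<bullet> (\<nu> - b))"
        and nn: "\<not> negligible {t \<in> ?Z. t + r *\<^sub>R (\<nu> - b) \<in> ?Z}"
      by (rule ex_small_recurrent_translation[OF cl less.prems(2) pos])
    define h where "h = r *\<^sub>R (\<nu> - b)"
    have neq: "character \<nu> h \<noteq> character b h"
      unfolding h_def using b r by (intro character_neq) auto
    define d where "d \<mu> = (character \<mu> h - character b h) *\<^sub>C c \<mu>" for \<mu>
    have "d b = 0"
      by (simp add: d_def)
    let ?f' = "\<lambda>t. \<Sum>\<mu>\<in>S - {b}. character \<mu> t *\<^sub>C d \<mu>"
    have summand: "character \<mu> t *\<^sub>C d \<mu>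
        = character \<mu> (t + h) *\<^sub>C c \<mu> - character b h *\<^sub>C (character \<mu> t *\<^sub>C c \<mu>)" for \<mu> t
      unfolding d_def scaleC_scaleC character_add scaleC_diff_left[symmetric] right_diff_distrib
      by (simp only: mult.commute)
    have eq: "?f' t = ?f S (t + h) - character b h *\<^sub>C ?f S t" for t
    proof -
      have "?f S (t + h) - character b h *\<^sub>C ?f S t
          = (\<Sum>\<mu>\<in>S. character \<mu> (t + h) *\<^sub>C c \<mu> - character b h *\<^sub>C (character \<mu> t *\<^sub>C c \<mu>))"
        by (simp only: scaleC_sum_right sum_subtractf)
      also have "\<dots> = (\<Sum>\<mu>\<in>S. character \<mu> t *\<^sub>C d \<mu>)"
        by (simp only: summand)
      also have "\<dots> = ?f' t"
        using sum.remove[OF less.prems(1) b(1), of "\<lambda>\<mu>. character \<mu> t *\<^sub>C d \<mu>"] by (simp add: \<open>d b = 0\<close>)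
      finally show ?thesis ..
    qed
    have "{t \<in> ?Z. t + h \<in> ?Z} \<subseteq> {t. ?f' t = 0}"
      unfolding eq by auto
    then have "\<not> negligible {t. ?f' t = 0}"
      using nn negligible_subset unfolding h_def by blast
    moreover have "card (S - {b}) < card S"
      using less.prems(1) b by (intro psubset_card_mono) auto
    ultimately have "d \<nu> = 0"
      using less.prems(1,3) b less.hyps[of "S - {b}" d \<nu>] by simp
    then show ?thesis
      using neq by (simp add: d_def scaleC_eq_0_iff)
  qed
qed

lemma trig_poly_eq_character:
  "trig_poly P \<longleftrightarrow> (\<exists>(L::nat) lam c.
      (\<forall>l<L. continuous_on UNIV (c l) \<and> (\<forall>S. bounded S \<longrightarrow> bounded (c l ` S))) \<and>
      P = (\<lambda>t x. \<Sum>l<L. character (lam l) t *\<^sub>C c l x))"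
  by (simp add: trig_poly_def character_def)

lemma trig_polyI:
  assumes "finite I"
    and "\<And>i. i \<in> I \<Longrightarrow> continuous_on UNIV (c i)"
    and "\<And>i S. i \<in> I \<Longrightarrow> bounded S \<Longrightarrow> bounded (c i ` S)"
  shows "trig_poly (\<lambda>t x. \<Sum>i\<in>I. character (lam i) t *\<^sub>C c i x)"
proof -
  obtain h where h: "bij_betw h {..<card I} I"
    using ex_bij_betw_nat_finite[OF \<open>finite I\<close>] by (auto simp: atLeast0LessThan)
  then have hI: "h l \<in> I" if "l < card I" for l
    using that by (auto simp: bij_betw_def)
  have "(\<Sum>i\<in>I. character (lam i) t *\<^sub>C c i x)
      = (\<Sum>l<card I. character (lam (h l)) t *\<^sub>C c (h l) x)" for t x
    by (rule sum.reindex_bij_betw[OF h, symmetric])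
  then show ?thesis
    unfolding trig_poly_eq_character using assms(2,3) hI
    by (intro exI[of _ "card I"] exI[of _ "\<lambda>l. lam (h l)"] exI[of _ "\<lambda>l. c (h l)"]) auto
qed

lemma trig_polyE:
  assumes "trig_poly P"
  obtains L :: nat and c lam
  where "\<And>l. l < L \<Longrightarrow> continuous_on UNIV (c l)"
    and "\<And>l S. l < L \<Longrightarrow> bounded S \<Longrightarrow> bounded (c l ` S)"
    and "P = (\<lambda>t x. \<Sum>l<L. character (lam l) t *\<^sub>C c l x)"
  using assms unfolding trig_poly_eq_character by blast

lemma trig_poly_0: "trig_poly (\<lambda>t x. 0)"
  using trig_polyI[of "{} :: nat set"] by simp

lemma trig_poly_add:
  assumes "trig_poly P" "trig_poly Q"
  shows "trig_poly (\<lambda>t x. P t x + Q t x)"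
proof -
  from assms(1) obtain L :: nat and lam c
    where 1: "\<And>l. l < L \<Longrightarrow> continuous_on UNIV (c l)"
      "\<And>l S. l < L \<Longrightarrow> bounded S \<Longrightarrow> bounded (c l ` S)"
      and P: "P = (\<lambda>t x. \<Sum>l<L. character (lam l) t *\<^sub>C c l x)"
    using trig_polyE by blast
  from assms(2) obtain K :: nat and mu d
    where 2: "\<And>l. l < K \<Longrightarrow> continuous_on UNIV (d l)"
      "\<And>l S. l < K \<Longrightarrow> bounded S \<Longrightarrow> bounded (d l ` S)"
      and Q: "Q = (\<lambda>t x. \<Sum>l<K. character (mu l) t *\<^sub>C d l x)"
    using trig_polyE by blast
  have "trig_poly (\<lambda>t x. \<Sum>i\<in>{..<L} <+> {..<K}.
      character (case_sum lam mu i) t *\<^sub>C case_sum c d i x)"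
    using 1 2 by (intro trig_polyI) auto
  then show ?thesis
    by (simp add: P Q sum.Plus)
qed

lemma trig_poly_scaleR:
  assumes P: "trig_poly P" and g: "continuous_on UNIV g" "\<And>x. \<bar>g x\<bar> \<le> 1"
  shows "trig_poly (\<lambda>t x. g x *\<^sub>R P t x)"
proof -
  from P obtain L :: nat and lam c
    where c: "\<And>l. l < L \<Longrightarrow> continuous_on UNIV (c l)"
      "\<And>l S. l < L \<Longrightarrow> bounded S \<Longrightarrow> bounded (c l ` S)"
      and P: "P = (\<lambda>t x. \<Sum>l<L. character (lam l) t *\<^sub>C c l x)"
    using trig_polyE by blast
  have "bounded ((\<lambda>x. g x *\<^sub>R c l x) ` S)" if l: "l < L" and S: "bounded S" for l S
  proof -
    obtain K where "\<And>x. x \<in> S \<Longrightarrow> norm (c l x) \<le> K"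
      using c(2)[OF l S] by (auto simp: bounded_iff)
    then have "norm (g x *\<^sub>R c l x) \<le> 1 * K" if "x \<in> S" for x
      using that g(2)[of x] unfolding norm_scaleR by (intro mult_mono) auto
    then show ?thesis
      unfolding bounded_iff by blast
  qed
  then have "trig_poly (\<lambda>t x. \<Sum>l<L. character (lam l) t *\<^sub>C (g x *\<^sub>R c l x))"
    using c g by (intro trig_polyI) (auto intro!: continuous_intros)
  then show ?thesis
    by (simp add: P scaleR_sum_right scaleC_scaleR_commute)
qed

lemma trig_poly_diff:
  assumes "trig_poly P" "trig_poly Q"
  shows "trig_poly (\<lambda>t x. P t x - Q t x)"
  using trig_poly_add[OF assms(1) trig_poly_scaleR[OF assms(2), of "\<lambda>_. -1"]] by simp

lemma trig_poly_sum:
  assumes "\<And>i. i \<in> I \<Longrightarrow> trig_poly (P i)"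
  shows "trig_poly (\<lambda>t x. \<Sum>i\<in>I. P i t x)"
  using assms
  by (induction I rule: infinite_finite_induct) (auto intro: trig_poly_0 trig_poly_add)

lemma trig_poly_continuous:
  assumes "trig_poly P"
  shows "continuous_on S (\<lambda>t. P t x)"
  using assms by (elim trig_polyE) (simp add: continuous_on_character_sum)

lemma trig_poly_bounded:
  assumes "trig_poly P" "bounded B"
  obtains K where "\<And>t x. x \<in> B \<Longrightarrow> norm (P t x) \<le> K"
proof -
  obtain L :: nat and lam c
    where c: "\<And>l S. l < (L::nat) \<Longrightarrow> bounded S \<Longrightarrow> bounded (c l ` S)"
      and P: "P = (\<lambda>t x. \<Sum>l<L. character (lam l) t *\<^sub>C c l x)"
    using trig_polyE[OF assms(1)] by blast
  have "\<exists>K. \<forall>x\<in>B. norm (c l x) \<le> K" if "l < L" for l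
    using c[OF that assms(2)] by (auto simp: bounded_iff)
  then obtain K where K: "\<And>l x. l < L \<Longrightarrow> x \<in> B \<Longrightarrow> norm (c l x) \<le> K l"
    by metis
  have "norm (P t x) \<le> (\<Sum>l<L. K l)" if "x \<in> B" for t x
    unfolding P using K that by (intro sum_norm_le) (simp add: norm_scaleC)
  then show ?thesis by (rule that)
qed

lemma trig_poly_zeros:
  assumes "trig_poly P" "\<not> negligible {t. P t x = 0}"
  shows "P t x = 0"
proof -
  obtain L lam c where P: "P = (\<lambda>t x. \<Sum>l<(L::nat). character (lam l) t *\<^sub>C c l x)"
    using trig_polyE[OF assms(1)] by blast
  define d where "d \<mu> = (\<Sum>l | l < L \<and> lam l = \<mu>. c l x)" for \<mu>
  have eq: "P t x = (\<Sum>\<mu>\<in>lam ` {..<L}. character \<mu> t *\<^sub>C d \<mu>)" for t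
  proof -
    have "P t x = (\<Sum>\<mu>\<in>lam ` {..<L}. \<Sum>l | l \<in> {..<L} \<and> lam l = \<mu>. character (lam l) t *\<^sub>C c l x)"
      unfolding P by (rule sum.image_gen) simp
    also have "\<dots> = (\<Sum>\<mu>\<in>lam ` {..<L}. character \<mu> t *\<^sub>C d \<mu>)"
      unfolding d_def scaleC_sum_right by (intro sum.cong) auto
    finally show ?thesis .
  qed
  have "d \<mu> = 0" if "\<mu> \<in> lam ` {..<L}" for \<mu>
    using that assms(2) unfolding eq by (intro character_sum_zeros_not_negligible) auto
  then show ?thesis
    by (simp add: eq)
qed

section \<open>The weighted distances\<close>

lemma continuous_borel_measurable_restrict_lebesgue:
  fixes f :: "'a::euclidean_space \<Rightarrow> 'b::topological_space"
  assumes "continuous_on UNIV f"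
  shows "f \<in> borel_measurable (restrict_space lebesgue \<Omega>)"
  using assms
  by (intro measurable_restrict_space1 measurable_completion) (simp add: borel_measurable_continuous_onI)

text \<open>The codomain need not be second countable, so that \<open>F - P\<close> may fail to be Borel measurable for
  Borel measurable \<open>F\<close> and \<open>P\<close>. If \<open>P\<close> is continuous, then the distance is an infimum over a
  countable dense set.\<close>

lemma borel_measurable_norm_diff_continuous:
  fixes F P :: "'a::euclidean_space \<Rightarrow> 'b::real_normed_vector"
  assumes F: "F \<in> borel_measurable (restrict_space lebesgue \<Omega>)" and P: "continuous_on UNIV P"
  shows "(\<lambda>s. norm (F s - P s)) \<in> borel_measurable (restrict_space lebesgue \<Omega>)"
proof -
  obtain D :: "'a set" where D: "countable D" "\<And>U. open U \<Longrightarrow> U \<noteq> {} \<Longrightarrow> \<exists>d\<in>D. d \<in> U"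
    using countable_dense_setE by blast
  define f where "f s q = norm (F s - P q) + norm (P q - P s)" for s q
  have bdd: "bdd_below (f s ` D)" for s
    by (rule bdd_belowI[of _ 0]) (auto simp: f_def)
  have "D \<noteq> {}"
    using D(2)[of UNIV] by auto
  have eq: "norm (F s - P s) = (INF q\<in>D. f s q)" for s
  proof (rule antisym)
    show "norm (F s - P s) \<le> (INF q\<in>D. f s q)"
      using \<open>D \<noteq> {}\<close> by (intro cINF_greatest) (auto simp: f_def intro: order_trans[OF _ norm_triangle_ineq])
    show "(INF q\<in>D. f s q) \<le> norm (F s - P s)"
    proof (rule field_le_epsilon)
      fix e :: real assume "0 < e"
      have "open {q. f s q < norm (F s - P s) + e}"
        unfolding f_def by (intro open_Collect_less continuous_intros P)
      moreover have "s \<in> {q. f s q < norm (F s - P s) + e}"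
        using \<open>0 < e\<close> by (simp add: f_def)
      ultimately obtain d where "d \<in> D" "f s d < norm (F s - P s) + e"
        using D(2) by blast
      then show "(INF q\<in>D. f s q) \<le> norm (F s - P s) + e"
        using cINF_lower[OF bdd \<open>d \<in> D\<close>] by (meson less_imp_le order_trans)
    qed
  qed
  have "(\<lambda>s. f s q) \<in> borel_measurable (restrict_space lebesgue \<Omega>)" for q
  proof -
    have "(\<lambda>y. norm (y - P q)) \<in> borel_measurable borel"
      by (intro borel_measurable_continuous_onI continuous_intros)
    from measurable_compose[OF F this]
    have "(\<lambda>s. norm (F s - P q)) \<in> borel_measurable (restrict_space lebesgue \<Omega>)" .
    moreover have "(\<lambda>s. norm (P q - P s)) \<in> borel_measurable (restrict_space lebesgue \<Omega>)"
      by (intro continuous_borel_measurable_restrict_lebesgue continuous_intros P)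
    ultimately show ?thesis
      unfolding f_def by (rule borel_measurable_add)
  qed
  then show ?thesis
    unfolding eq using D(1) bdd by (intro borel_measurable_cINF) auto
qed

locale weighted_luxemburg =
  fixes \<Lambda> :: "(real ^ 'n) set"
    and p :: "real ^ 'n \<Rightarrow> ennreal"
    and \<omega> :: "real \<Rightarrow> real"
    and \<phi> :: "real \<Rightarrow> real"
  assumes Lam_meas: "\<Lambda> \<in> sets lebesgue"
    and p_meas: "p \<in> borel_measurable (restrict_space lebesgue \<Lambda>)"
    and p_ge1: "\<And>s. s \<in> \<Lambda> \<Longrightarrow> 1 \<le> p s"
    and omega_pos: "\<And>t. 0 < t \<Longrightarrow> 0 < \<omega> t"
    and omega_tendsto: "(\<omega> \<longlongrightarrow> 0) at_top"
    and phi_nonneg: "\<And>u. 0 \<le> u \<Longrightarrow> 0 \<le> \<phi> u"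
    and phi_mono: "\<And>u v. 0 \<le> u \<Longrightarrow> u \<le> v \<Longrightarrow> \<phi> u \<le> \<phi> v"
    and phi_add: "\<And>u v. 0 \<le> u \<Longrightarrow> 0 \<le> v \<Longrightarrow> \<phi> (u + v) \<le> \<phi> u + \<phi> v"
    and weight: "\<forall>\<^sub>F t in at_top. ennreal (\<omega> t) * luxnorm p (Lam_t \<Lambda> t) (\<lambda>_. 1) \<le> 1"
begin

definition wnorm :: "real \<Rightarrow> 'x set \<Rightarrow> (real ^ 'n \<Rightarrow> 'x \<Rightarrow> real) \<Rightarrow> ennreal"
  where "wnorm t B w = ennreal (\<omega> t) * (SUP x\<in>B. luxnorm p (Lam_t \<Lambda> t) (\<lambda>s. w s x))"

definition wlim :: "'x set \<Rightarrow> (real ^ 'n \<Rightarrow> 'x \<Rightarrow> real) \<Rightarrow> ennreal"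
  where "wlim B w = Limsup at_top (\<lambda>t. wnorm t B w)"

abbreviation dB :: "'x set \<Rightarrow> (real ^ 'n \<Rightarrow> 'x \<Rightarrow> 'y::real_normed_vector) \<Rightarrow> (real ^ 'n \<Rightarrow> 'x \<Rightarrow> 'y) \<Rightarrow> ennreal"
  where "dB \<equiv> dist_B \<phi> \<omega> p \<Lambda>"

abbreviation gap :: "(real ^ 'n \<Rightarrow> 'x \<Rightarrow> 'y::real_normed_vector) \<Rightarrow> (real ^ 'n \<Rightarrow> 'x \<Rightarrow> 'y) \<Rightarrow> real ^ 'n \<Rightarrow> 'x \<Rightarrow> real"
  where "gap F G \<equiv> \<lambda>s x. \<phi> (norm (F s x - G s x))"

definition sections_meas :: "(real ^ 'n \<Rightarrow> 'x \<Rightarrow> 'y::topological_space) \<Rightarrow> bool"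
  where "sections_meas F \<longleftrightarrow> (\<forall>x. (\<lambda>s. F s x) \<in> borel_measurable (restrict_space lebesgue \<Lambda>))"

lemma dist_B_eq_wlim: "dB B F G = wlim B (gap F G)"
  by (simp add: dist_B_def wlim_def wnorm_def)

lemma Lam_t_subset: "Lam_t \<Lambda> t \<subseteq> \<Lambda>"
  by (auto simp: Lam_t_def)

lemma Lam_t_mono: "t \<le> t' \<Longrightarrow> Lam_t \<Lambda> t \<subseteq> Lam_t \<Lambda> t'"
  by (auto simp: Lam_t_def intro: order_trans)

lemma closed_box: "closed {v :: real ^ 'n. \<forall>i. \<bar>v $ i\<bar> \<le> t}"
  by (intro closed_Collect_all closed_Collect_le continuous_intros)

lemma Lam_t_sets: "Lam_t \<Lambda> t \<in> sets lebesgue"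
proof -
  have "{v :: real ^ 'n. \<forall>i. \<bar>v $ i\<bar> \<le> t} \<in> sets lebesgue"
    using closed_box by (intro sets_completionI_sets) auto
  then show ?thesis
    unfolding Lam_t_def using Lam_meas by (rule sets.Int[rotated])
qed

lemma phi_diff_le:
  "\<phi> (norm (a - c)) \<le> \<phi> (norm (a - b)) + \<phi> (norm (b - c))"
  for a b c :: "'y::real_normed_vector"
proof -
  have "\<phi> (norm (a - c)) \<le> \<phi> (norm (a - b) + norm (b - c))"
    using norm_triangle_ineq[of "a - b" "b - c"] by (intro phi_mono) auto
  also have "\<dots> \<le> \<phi> (norm (a - b)) + \<phi> (norm (b - c))"
    by (intro phi_add) auto
  finally show ?thesis .
qed

lemma phi_measurable:
  assumes [measurable]: "f \<in> borel_measurable M" and f: "\<And>s. 0 \<le> f s"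
  shows "(\<lambda>s. \<phi> (f s)) \<in> borel_measurable M"
proof -
  have "mono (\<lambda>u. \<phi> (max 0 u))"
    by (intro monoI phi_mono) auto
  then have [measurable]: "(\<lambda>u. \<phi> (max 0 u)) \<in> borel_measurable borel"
    by (rule borel_measurable_mono)
  have "(\<lambda>s. \<phi> (max 0 (f s))) \<in> borel_measurable M"
    by measurable
  then show ?thesis
    using f by (simp add: max_def)
qed

lemma wnorm_mono:
  assumes "B \<subseteq> B'" "\<And>s x. s \<in> Lam_t \<Lambda> t \<Longrightarrow> x \<in> B \<Longrightarrow> 0 \<le> u s x" "\<And>s x. s \<in> Lam_t \<Lambda> t \<Longrightarrow> x \<in> B \<Longrightarrow> u s x \<le> v s x"
  shows "wnorm t B u \<le> wnorm t B' v"
  unfolding wnorm_def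
proof (intro mult_left_mono SUP_mono)
  fix x assume "x \<in> B"
  then have "luxnorm p (Lam_t \<Lambda> t) (\<lambda>s. u s x) \<le> luxnorm p (Lam_t \<Lambda> t) (\<lambda>s. v s x)"
    using assms Lam_t_subset[of t] by (intro luxnorm_mono) auto
  then show "\<exists>y\<in>B'. luxnorm p (Lam_t \<Lambda> t) (\<lambda>s. u s x) \<le> luxnorm p (Lam_t \<Lambda> t) (\<lambda>s. v s y)"
    using \<open>x \<in> B\<close> assms(1) by blast
qed simp

lemma wnorm_add:
  assumes u: "\<And>x. x \<in> B \<Longrightarrow> (\<lambda>s. u s x) \<in> borel_measurable (restrict_space lebesgue \<Lambda>)"
    and v: "\<And>x. x \<in> B \<Longrightarrow> (\<lambda>s. v s x) \<in> borel_measurable (restrict_space lebesgue \<Lambda>)"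
    and nonneg: "\<And>s x. s \<in> Lam_t \<Lambda> t \<Longrightarrow> x \<in> B \<Longrightarrow> 0 \<le> u s x" "\<And>s x. s \<in> Lam_t \<Lambda> t \<Longrightarrow> x \<in> B \<Longrightarrow> 0 \<le> v s x"
      "\<And>s x. s \<in> Lam_t \<Lambda> t \<Longrightarrow> x \<in> B \<Longrightarrow> 0 \<le> w s x"
    and le: "\<And>s x. s \<in> Lam_t \<Lambda> t \<Longrightarrow> x \<in> B \<Longrightarrow> w s x \<le> u s x + v s x"
  shows "wnorm t B w \<le> wnorm t B u + wnorm t B v"
proof -
  let ?\<Omega> = "Lam_t \<Lambda> t"
  have "(SUP x\<in>B. luxnorm p ?\<Omega> (\<lambda>s. w s x))
      \<le> (SUP x\<in>B. luxnorm p ?\<Omega> (\<lambda>s. u s x)) + (SUP x\<in>B. luxnorm p ?\<Omega> (\<lambda>s. v s x))"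
  proof (rule SUP_least)
    fix x assume x: "x \<in> B"
    have "luxnorm p ?\<Omega> (\<lambda>s. w s x) \<le> luxnorm p ?\<Omega> (\<lambda>s. u s x + v s x)"
      using x nonneg le Lam_t_subset[of t] by (intro luxnorm_mono) auto
    also have "\<dots> \<le> luxnorm p ?\<Omega> (\<lambda>s. u s x) + luxnorm p ?\<Omega> (\<lambda>s. v s x)"
      using x nonneg p_ge1 Lam_t_subset[of t] u v p_meas
      by (intro luxnorm_add Lam_t_sets measurable_restrict_mono[OF _ Lam_t_subset]) auto
    also have "\<dots> \<le> (SUP x\<in>B. luxnorm p ?\<Omega> (\<lambda>s. u s x)) + (SUP x\<in>B. luxnorm p ?\<Omega> (\<lambda>s. v s x))"
      using x by (intro add_mono SUP_upper)
    finally show "luxnorm p ?\<Omega> (\<lambda>s. w s x)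
      \<le> (SUP x\<in>B. luxnorm p ?\<Omega> (\<lambda>s. u s x)) + (SUP x\<in>B. luxnorm p ?\<Omega> (\<lambda>s. v s x))" .
  qed
  then show ?thesis
    unfolding wnorm_def distrib_left[symmetric] by (rule mult_left_mono) simp
qed

lemma wnorm_le_luxnorm:
  assumes "\<And>x. x \<in> B \<Longrightarrow> luxnorm p (Lam_t \<Lambda> t) (\<lambda>s. w s x) \<le> c"
  shows "wnorm t B w \<le> ennreal (\<omega> t) * c"
  unfolding wnorm_def using assms by (intro mult_left_mono SUP_least) auto

lemma wlim_mono:
  assumes "B \<subseteq> B'" "\<And>s x. s \<in> \<Lambda> \<Longrightarrow> x \<in> B \<Longrightarrow> 0 \<le> u s x" "\<And>s x. s \<in> \<Lambda> \<Longrightarrow> x \<in> B \<Longrightarrow> u s x \<le> v s x"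
  shows "wlim B u \<le> wlim B' v"
  unfolding wlim_def using assms Lam_t_subset
  by (intro Limsup_mono always_eventually allI wnorm_mono) blast+

lemma wlim_add:
  assumes "\<And>x. x \<in> B \<Longrightarrow> (\<lambda>s. u s x) \<in> borel_measurable (restrict_space lebesgue \<Lambda>)"
    and "\<And>x. x \<in> B \<Longrightarrow> (\<lambda>s. v s x) \<in> borel_measurable (restrict_space lebesgue \<Lambda>)"
    and "\<And>s x. s \<in> \<Lambda> \<Longrightarrow> x \<in> B \<Longrightarrow> 0 \<le> u s x" "\<And>s x. s \<in> \<Lambda> \<Longrightarrow> x \<in> B \<Longrightarrow> 0 \<le> v s x"
      "\<And>s x. s \<in> \<Lambda> \<Longrightarrow> x \<in> B \<Longrightarrow> 0 \<le> w s x"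
    and "\<And>s x. s \<in> \<Lambda> \<Longrightarrow> x \<in> B \<Longrightarrow> w s x \<le> u s x + v s x"
  shows "wlim B w \<le> wlim B u + wlim B v"
proof -
  have "wlim B w \<le> Limsup at_top (\<lambda>t. wnorm t B u + wnorm t B v)"
    unfolding wlim_def using assms Lam_t_subset
    by (intro Limsup_mono always_eventually allI wnorm_add) blast+
  also have "\<dots> \<le> wlim B u + wlim B v"
    unfolding wlim_def by (rule Limsup_add_le_ennreal)
  finally show ?thesis .
qed

lemma wlim_const_le:
  assumes "0 \<le> c"
  shows "wlim B (\<lambda>_ _. c) \<le> ennreal c"
  unfolding wlim_def
proof (rule Limsup_bounded, use weight in eventually_elim)
  case (elim t)
  have "wnorm t B (\<lambda>_ _. c) \<le> ennreal (\<omega> t) * (ennreal c * luxnorm p (Lam_t \<Lambda> t) (\<lambda>_. 1))"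
    using luxnorm_const_le[OF assms] by (rule wnorm_le_luxnorm)
  also have "\<dots> = ennreal c * (ennreal (\<omega> t) * luxnorm p (Lam_t \<Lambda> t) (\<lambda>_. 1))"
    by (simp add: ac_simps)
  also have "\<dots> \<le> ennreal c * 1"
    using elim by (rule mult_left_mono) simp
  finally show ?case by simp
qed

lemma wlim_const_eq_0:
  assumes "0 < c" "wlim B (\<lambda>_ _. c) = 0" "0 \<le> a"
  shows "wlim B (\<lambda>_ _. a) = 0"
proof -
  have *: "wlim B (\<lambda>_ _. real n * c) = 0" for n
  proof (induction n)
    case 0
    then show ?case using wlim_const_le[of 0 B] by simp
  next
    case (Suc n)
    have "wlim B (\<lambda>_ _. real (Suc n) * c) \<le> wlim B (\<lambda>_ _. real n * c) + wlim B (\<lambda>_ _. c)"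
      using \<open>0 < c\<close> by (intro wlim_add) (auto simp: distrib_right)
    then show ?case using Suc assms(2) by simp
  qed
  obtain n where "a < real n * c"
    using reals_Archimedean3[OF \<open>0 < c\<close>] by blast
  then have "wlim B (\<lambda>_ _. a) \<le> wlim B (\<lambda>_ _. real n * c)"
    using \<open>0 \<le> a\<close> by (intro wlim_mono) auto
  then show ?thesis using * by simp
qed

lemma wlim_const_indep:
  assumes "B \<noteq> {}" "B' \<noteq> {}"
  shows "wlim B (\<lambda>_ _. c) = wlim B' (\<lambda>_ _. c)"
  using assms by (simp add: wlim_def wnorm_def)

lemma dist_B_commute: "dB B F G = dB B G F"
  by (simp add: dist_B_def norm_minus_commute)

lemma dist_B_mono: "B \<subseteq> B' \<Longrightarrow> dB B F G \<le> dB B' F G"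
  unfolding dist_B_eq_wlim by (intro wlim_mono) (auto intro: phi_nonneg)

lemma trig_poly_sections_meas: "trig_poly P \<Longrightarrow> sections_meas P"
  unfolding sections_meas_def
  by (intro allI continuous_borel_measurable_restrict_lebesgue trig_poly_continuous)

lemma gap_measurable:
  assumes "sections_meas F" "trig_poly P"
  shows "(\<lambda>s. gap F P s x) \<in> borel_measurable (restrict_space lebesgue \<Lambda>)"
  using assms unfolding sections_meas_def
  by (intro phi_measurable borel_measurable_norm_diff_continuous trig_poly_continuous) auto

lemma dist_B_triangle_trig_mid:
  assumes "sections_meas F" "sections_meas H" "trig_poly P"
  shows "dB B F H \<le> dB B F P + dB B H P"
  unfolding dist_B_eq_wlim using assms
proof (intro wlim_add gap_measurable phi_nonneg norm_ge_zero)
  fix s x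
  show "gap F H s x \<le> gap F P s x + gap H P s x"
    using phi_diff_le[of "F s x" "H s x" "P s x"] by (simp add: norm_minus_commute)
qed

text \<open>Here \<open>gap F G\<close> may be non-measurable, but it dominates the measurable function
  \<open>max 0 (gap F P - gap G P)\<close>.\<close>

lemma dist_B_triangle_trig_right:
  assumes "sections_meas F" "sections_meas G" "trig_poly P"
  shows "dB B F P \<le> dB B F G + dB B G P"
proof -
  define m where "m s x = max 0 (gap F P s x - gap G P s x)" for s x
  have "(\<lambda>s. m s x) \<in> borel_measurable (restrict_space lebesgue \<Lambda>)" for x
    unfolding m_def using gap_measurable[OF assms(1,3)] gap_measurable[OF assms(2,3)]
    by (intro borel_measurable_max borel_measurable_diff borel_measurable_const)
  then have "wlim B (gap F P) \<le> wlim B m + wlim B (gap G P)"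
    using assms by (intro wlim_add gap_measurable phi_nonneg norm_ge_zero) (auto simp: m_def)
  also have "wlim B m \<le> wlim B (gap F G)"
    using phi_diff_le by (intro wlim_mono) (auto simp: m_def intro: phi_nonneg simp: diff_le_eq)
  finally show ?thesis
    unfolding dist_B_eq_wlim by (simp add: add_right_mono)
qed

definition approximable :: "'x set \<Rightarrow> (real ^ 'n \<Rightarrow> 'x::real_normed_vector \<Rightarrow> 'y::complex_normed_vector) \<Rightarrow> bool"
  where "approximable B F \<longleftrightarrow>
    sections_meas F \<and> (\<exists>P. (\<forall>k. trig_poly (P k)) \<and> (\<lambda>k. dB B F (P k)) \<longlonglongrightarrow> 0)"

lemma approximable_sections_meas: "approximable B F \<Longrightarrow> sections_meas F"
  by (simp add: approximable_def)

lemma approximableE: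
  assumes "approximable B F" "0 < e"
  obtains P where "trig_poly P" "dB B F P < e"
proof -
  obtain P where P: "\<And>k. trig_poly (P k)" "(\<lambda>k. dB B F (P k)) \<longlonglongrightarrow> 0"
    using assms by (auto simp: approximable_def)
  from P(2) \<open>0 < e\<close> have "\<forall>\<^sub>F k in sequentially. dB B F (P k) < e"
    by (rule order_tendstoD)
  then show ?thesis
    using that P(1) by (auto simp: eventually_sequentially)
qed

lemma e_Besicovitch_iff:
  assumes "\<B> \<noteq> {}"
  shows "F \<in> e_Besicovitch \<B> \<phi> \<omega> p \<Lambda> \<longleftrightarrow> (\<forall>B\<in>\<B>. approximable B F)"
  using assms by (auto simp: e_Besicovitch_def approximable_def sections_meas_def)

lemma dist_B_triangle:
  assumes "sections_meas F" "approximable B G" "sections_meas H"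
  shows "dB B F H \<le> dB B F G + dB B G H"
proof (rule ennreal_le_epsilon)
  fix e :: real assume "0 < e"
  obtain P where P: "trig_poly P" "dB B G P < ennreal (e/2)"
    using approximableE[OF assms(2), of "ennreal (e/2)"] \<open>0 < e\<close> by auto
  have G: "sections_meas G"
    using assms(2) by (rule approximable_sections_meas)
  have "dB B F H \<le> dB B F P + dB B H P"
    using assms P by (intro dist_B_triangle_trig_mid)
  also have "\<dots> \<le> (dB B F G + dB B G P) + (dB B H G + dB B G P)"
    using assms P G by (intro add_mono dist_B_triangle_trig_right)
  also have "\<dots> \<le> (dB B F G + ennreal (e/2)) + (dB B H G + ennreal (e/2))"
    using P by (intro add_mono) auto
  also have "\<dots> = dB B F G + dB B G H + (ennreal (e/2) + ennreal (e/2))"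
    by (simp add: dist_B_commute[of B H G] ac_simps)
  also have "ennreal (e/2) + ennreal (e/2) = ennreal e"
    using \<open>0 < e\<close> by (simp flip: ennreal_plus)
  finally show "dB B F H \<le> dB B F G + dB B G H + ennreal e" .
qed

lemma wlim_phi_0:
  assumes "approximable B F"
  shows "wlim B (\<lambda>_ _. \<phi> 0) = 0"
proof -
  have "wlim B (\<lambda>_ _. \<phi> 0) < e" if e: "0 < e" for e
  proof -
    obtain P where "dB B F P < e"
      using approximableE[OF assms e] .
    moreover have "wlim B (\<lambda>_ _. \<phi> 0) \<le> dB B F P"
      unfolding dist_B_eq_wlim by (intro wlim_mono) (auto intro: phi_nonneg phi_mono)
    ultimately show ?thesis by simp
  qed
  then show ?thesis
    by (meson less_irrefl not_gr_zero)
qed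

lemma dist_B_self:
  assumes "approximable B F"
  shows "dB B F F = 0"
  using wlim_phi_0[OF assms] by (simp add: dist_B_eq_wlim)

lemma dist_B_trig_le:
  assumes "trig_poly P" "trig_poly Q" "bounded B"
  obtains K where "0 \<le> K" "dB B P Q \<le> wlim B (\<lambda>_ _. K)"
proof -
  obtain K where K: "\<And>t x. x \<in> B \<Longrightarrow> norm (P t x - Q t x) \<le> K"
    using trig_poly_bounded[OF trig_poly_diff[OF assms(1,2)] assms(3)] by metis
  have "dB B P Q \<le> wlim B (\<lambda>_ _. \<phi> (max 0 K))"
    unfolding dist_B_eq_wlim
    using K by (intro wlim_mono) (auto intro!: phi_nonneg phi_mono simp: le_max_iff_disj)
  then show ?thesis
    using that phi_nonneg[of "max 0 K"] by simp
qed

lemma dist_B_finite: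
  assumes F: "approximable B F" and G: "approximable B G" and "bounded B"
  shows "dB B F G < top"
proof -
  obtain P where P: "trig_poly P" "dB B F P < 1"
    using approximableE[OF F, of 1] by auto
  obtain Q where Q: "trig_poly Q" "dB B G Q < 1"
    using approximableE[OF G, of 1] by auto
  obtain K where K: "0 \<le> K" "dB B P Q \<le> wlim B (\<lambda>_ _. K)"
    using dist_B_trig_le[OF P(1) Q(1) \<open>bounded B\<close>] .
  have meas: "sections_meas F" "sections_meas G" "sections_meas P"
    using F G P trig_poly_sections_meas by (auto simp: approximable_def)
  have "dB B F G \<le> dB B F P + dB B G P"
    using meas P by (intro dist_B_triangle_trig_mid)
  also have "\<dots> \<le> dB B F P + (dB B G Q + dB B P Q)"
    using dist_B_triangle_trig_mid[OF meas(2,3) Q(1), of B] by (rule add_left_mono)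
  also have "\<dots> \<le> 1 + (1 + ennreal K)"
    using P Q K wlim_const_le[OF K(1), of B] by (intro add_mono) (auto intro: order_trans)
  also have "\<dots> < top"
    by simp
  finally show ?thesis .
qed

lemma dist_B_eq_0_if_wlim_1_eq_0:
  assumes F: "approximable B F" and G: "approximable B G" and "bounded B"
    and 0: "wlim B (\<lambda>_ _. 1) = 0"
  shows "dB B F G = 0"
proof -
  have meas: "sections_meas F" "sections_meas G"
    using F G by (auto simp: approximable_def)
  have "dB B F G \<le> ennreal e" if "0 < e" for e
  proof -
    obtain P where P: "trig_poly P" "dB B F P < ennreal (e/2)"
      using approximableE[OF F, of "ennreal (e/2)"] \<open>0 < e\<close> by auto
    obtain Q where Q: "trig_poly Q" "dB B G Q < ennreal (e/2)"
      using approximableE[OF G, of "ennreal (e/2)"] \<open>0 < e\<close> by auto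
    obtain K where K: "0 \<le> K" "dB B P Q \<le> wlim B (\<lambda>_ _. K)"
      using dist_B_trig_le[OF P(1) Q(1) \<open>bounded B\<close>] .
    have PQ: "dB B P Q = 0"
      using K wlim_const_eq_0[OF _ 0 K(1)] by simp
    have "dB B F G \<le> dB B F P + dB B G P"
      using meas P by (intro dist_B_triangle_trig_mid)
    also have "\<dots> \<le> dB B F P + (dB B G Q + dB B P Q)"
      using dist_B_triangle_trig_mid[OF meas(2) trig_poly_sections_meas[OF P(1)] Q(1), of B]
      by (rule add_left_mono)
    also have "\<dots> \<le> ennreal (e/2) + (ennreal (e/2) + 0)"
      using P Q PQ by (intro add_mono) auto
    also have "\<dots> = ennreal e"
      using \<open>0 < e\<close> by (simp flip: ennreal_plus)
    finally show ?thesis .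
  qed
  then show ?thesis
    using ennreal_le_epsilon[of 0 "dB B F G"] by simp
qed

section \<open>Extending small trigonometric polynomials from \<open>B\<close>\<close>

lemma wlim_reindex:
  assumes "h ` A \<subseteq> B"
  shows "wlim A (\<lambda>s x. w s (h x)) \<le> wlim B w"
  unfolding wlim_def wnorm_def using assms
  by (intro Limsup_mono always_eventually allI mult_left_mono SUP_mono) auto

lemma gap_0_measurable:
  assumes "trig_poly P"
  shows "(\<lambda>s. \<phi> (norm (P s x))) \<in> borel_measurable (restrict_space lebesgue \<Lambda>)"
  using gap_measurable[OF trig_poly_sections_meas[OF assms] trig_poly_0] by simp

lemma trig_poly_cutoff:
  fixes D :: "real ^ 'n \<Rightarrow> 'x::real_normed_vector \<Rightarrow> 'y::complex_normed_vector"
  assumes D: "trig_poly D" and B: "bounded B" "B \<noteq> {}" and \<eta>: "0 < \<eta>"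
  obtains D' where "trig_poly D'" "\<And>s x. x \<in> B \<Longrightarrow> D' s x = D s x"
    and "\<exists>K. \<forall>s x. norm (D' s x) \<le> K"
    and "wlim UNIV (\<lambda>s x. \<phi> (norm (D' s x))) \<le> wlim B (\<lambda>s x. \<phi> (norm (D s x))) + ennreal (\<phi> \<eta>)"
proof -
  from D obtain L :: nat and c lam
    where c: "\<And>l. l < L \<Longrightarrow> continuous_on UNIV (c l)"
      and D_eq: "D = (\<lambda>t x. \<Sum>l<L. character (lam l) t *\<^sub>C c l x)"
    using trig_polyE by blast
  define r where "r x y = (\<Sum>l<L. norm (c l x - c l y))" for x y
  define d where "d x = (INF b\<in>B. r x b)" for x
  define g where "g x = max 0 (1 - d x / \<eta>)" for x
  have r: "0 \<le> r x y" "r x y = r y x" "r x x = 0" for x y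
    by (auto simp: r_def norm_minus_commute intro: sum_nonneg)
  have r_tri: "r x z \<le> r x y + r y z" for x y z
    unfolding r_def sum.distrib[symmetric]
    by (intro sum_mono) (simp add: dist_triangle flip: dist_norm)
  have bdd: "bdd_below (r x ` B)" for x
    using r by (intro bdd_belowI[of _ 0]) auto
  have d_nonneg: "0 \<le> d x" for x
    unfolding d_def using B r by (intro cINF_greatest) auto
  have d_B: "d x = 0" if "x \<in> B" for x
    using cINF_lower[OF bdd that, of x] d_nonneg[of x] r by (simp add: d_def)
  have d_le: "d x \<le> d y + r x y" for x y
  proof -
    have "d x - r x y \<le> d y"
      unfolding d_def[of y]
    proof (rule cINF_greatest[OF B(2)])
      fix b assume "b \<in> B"
      then have "d x \<le> r x b"
        unfolding d_def by (rule cINF_lower[OF bdd])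
      then show "d x - r x y \<le> r y b"
        using r_tri[of x b y] by simp
    qed
    then show ?thesis by simp
  qed
  have "continuous_on UNIV d"
    unfolding continuous_on_def
  proof
    fix x
    have "continuous_on UNIV (\<lambda>y. r y x)"
      unfolding r_def by (intro continuous_intros c) auto
    then have "((\<lambda>y. r y x) \<longlongrightarrow> r x x) (at x)"
      unfolding continuous_on_def by blast
    then have "((\<lambda>y. r y x) \<longlongrightarrow> 0) (at x)"
      unfolding r(3) .
    moreover have "\<forall>\<^sub>F y in at x. norm (d y - d x) \<le> r y x"
      using d_le r(2) by (intro always_eventually allI) (smt (verit, best) real_norm_def)
    ultimately have "((\<lambda>y. d y - d x) \<longlongrightarrow> 0) (at x)"
      by (rule Lim_null_comparison[rotated])
    then show "(d \<longlongrightarrow> d x) (at x)"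
      by (simp add: LIM_zero_iff)
  qed
  then have g_cont: "continuous_on UNIV g"
    unfolding g_def using \<eta> by (intro continuous_intros) auto
  have g_le: "\<bar>g x\<bar> \<le> 1" "g x \<le> 1" "0 \<le> g x" for x
    using d_nonneg[of x] \<eta> by (auto simp: g_def)
  define D' where "D' s x = g x *\<^sub>R D s x" for s x
  have "\<exists>b\<in>B. \<forall>s. norm (D' s x) \<le> norm (D s b) + \<eta>" for x
  proof (cases "g x = 0")
    case True
    then show ?thesis using B \<eta> by (auto simp: D'_def intro: add_nonneg_nonneg)
  next
    case False
    then have "d x < \<eta>"
      using \<eta> d_nonneg[of x] by (auto simp: g_def max_def field_simps split: if_splits)
    then obtain b where b: "b \<in> B" "r x b < \<eta>"
      unfolding d_def using cINF_less_iff[OF B(2) bdd] by blast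
    have "norm (D' s x) \<le> norm (D s b) + \<eta>" for s
    proof -
      have "norm (D' s x) \<le> norm (D s x)"
        using g_le[of x] by (simp add: D'_def mult_left_le_one_le)
      also have "\<dots> \<le> norm (D s b) + norm (D s x - D s b)"
        using norm_triangle_ineq[of "D s b" "D s x - D s b"] by simp
      also have "norm (D s x - D s b) = norm (\<Sum>l<L. character (lam l) s *\<^sub>C (c l x - c l b))"
        by (simp add: D_eq sum_subtractf scaleC_diff_right)
      also have "\<dots> \<le> r x b"
        unfolding r_def by (rule sum_norm_le) (simp add: norm_scaleC)
      finally show ?thesis using b by simp
    qed
    then show ?thesis using b by blast
  qed
  then obtain h where h: "\<And>x. h x \<in> B" "\<And>s x. norm (D' s x) \<le> norm (D s (h x)) + \<eta>"
    by metis
  show ?thesis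
  proof (rule that)
    show tD': "trig_poly D'"
      unfolding D'_def using D g_cont g_le by (intro trig_poly_scaleR)
    show "D' s x = D s x" if "x \<in> B" for s x
      using d_B[OF that] by (simp add: D'_def g_def)
    obtain K where "\<And>t x. x \<in> B \<Longrightarrow> norm (D t x) \<le> K"
      using trig_poly_bounded[OF D B(1)] by blast
    then show "\<exists>K. \<forall>s x. norm (D' s x) \<le> K"
      using h by (intro exI[of _ "K + \<eta>"]) (meson add_right_mono order_trans)
    have "wlim UNIV (\<lambda>s x. \<phi> (norm (D' s x)))
        \<le> wlim UNIV (\<lambda>s x. \<phi> (norm (D s (h x)))) + wlim (UNIV :: 'x set) (\<lambda>_ _. \<phi> \<eta>)"
    proof (intro wlim_add gap_0_measurable D borel_measurable_const)
      fix s x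
      have "\<phi> (norm (D' s x)) \<le> \<phi> (norm (D s (h x)) + \<eta>)"
        using h by (intro phi_mono) auto
      also have "\<dots> \<le> \<phi> (norm (D s (h x))) + \<phi> \<eta>"
        using \<eta> by (intro phi_add) auto
      finally show "\<phi> (norm (D' s x)) \<le> \<phi> (norm (D s (h x))) + \<phi> \<eta>" .
    qed (use \<eta> in \<open>auto intro: phi_nonneg\<close>)
    also have "\<dots> \<le> wlim B (\<lambda>s x. \<phi> (norm (D s x))) + ennreal (\<phi> \<eta>)"
      using h(1) \<eta> by (intro add_mono wlim_reindex wlim_const_le phi_nonneg) auto
    finally show "wlim UNIV (\<lambda>s x. \<phi> (norm (D' s x)))
        \<le> wlim B (\<lambda>s x. \<phi> (norm (D s x))) + ennreal (\<phi> \<eta>)" .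
  qed
qed

text \<open>If \<open>\<phi>\<close> jumps at \<open>0\<close>, then trigonometric polynomials form a discrete set, since their zeros are
  negligible.\<close>

lemma trig_poly_rigid:
  assumes D: "trig_poly D" and \<phi>: "\<And>u. 0 < u \<Longrightarrow> c \<le> \<phi> u" and c: "0 \<le> c"
    and less: "wlim B (\<lambda>s x. \<phi> (norm (D s x))) < wlim B (\<lambda>_ _. c)" and x: "x \<in> B"
  shows "D t x = 0"
proof (rule ccontr)
  assume "D t x \<noteq> 0"
  then have "negligible {s. D s x = 0}"
    using trig_poly_zeros[OF D] by blast
  then have "AE s in lebesgue. D s x \<noteq> 0"
    using AE_not_in[of "{s. D s x = 0}" lebesgue] by (simp add: negligible_iff_null_sets)
  then have "AE s in lebesgue. s \<in> Lam_t \<Lambda> t \<longrightarrow> 0 \<le> c \<and> c \<le> \<phi> (norm (D s x))" for t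
    by eventually_elim (use \<phi> c in auto)
  then have "luxnorm p (Lam_t \<Lambda> t) (\<lambda>_. c) \<le> luxnorm p (Lam_t \<Lambda> t) (\<lambda>s. \<phi> (norm (D s x)))" for t
    by (rule luxnorm_mono_AE[OF subset_refl])
  also have "luxnorm p (Lam_t \<Lambda> t) (\<lambda>s. \<phi> (norm (D s x)))
      \<le> (SUP x\<in>B. luxnorm p (Lam_t \<Lambda> t) (\<lambda>s. \<phi> (norm (D s x))))" for t
    using x by (rule SUP_upper)
  finally have "wlim B (\<lambda>_ _. c) \<le> wlim B (\<lambda>s x. \<phi> (norm (D s x)))"
    unfolding wlim_def wnorm_def using x
    by (intro Limsup_mono always_eventually allI mult_left_mono SUP_least) auto
  then show False using less by simp
qed

definition controlled_extension ::
  "'x set \<Rightarrow> real \<Rightarrow> (real ^ 'n \<Rightarrow> 'x::real_normed_vector \<Rightarrow> 'y::complex_normed_vector)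
    \<Rightarrow> (real ^ 'n \<Rightarrow> 'x \<Rightarrow> 'y) \<Rightarrow> bool"
  where "controlled_extension B e D D' \<longleftrightarrow>
    trig_poly D' \<and> (\<forall>s. \<forall>x\<in>B. D' s x = D s x) \<and> (\<exists>K. \<forall>s x. norm (D' s x) \<le> K) \<and>
    wlim UNIV (\<lambda>s x. \<phi> (norm (D' s x))) \<le> ennreal (2 * e)"

lemma trig_poly_extension:
  fixes B :: "'x::real_normed_vector set"
  assumes B: "bounded B" "B \<noteq> {}" and 1: "wlim B (\<lambda>_ _. 1) \<noteq> 0" and 0: "wlim B (\<lambda>_ _. \<phi> 0) = 0"
  shows "\<exists>e0>0. \<forall>e D. 0 < e \<longrightarrow> e \<le> e0 \<longrightarrow> trig_poly D \<longrightarrow> wlim B (\<lambda>s x. \<phi> (norm (D s x))) < ennreal e \<longrightarrow>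
    (\<exists>D' :: real ^ 'n \<Rightarrow> 'x \<Rightarrow> 'y::complex_normed_vector. controlled_extension B e D D')"
proof (cases "\<forall>e>0. \<exists>\<eta>>0. \<phi> \<eta> \<le> e")
  case True
  show ?thesis
  proof (intro exI[of _ 1] conjI allI impI)
    fix e and D :: "real ^ 'n \<Rightarrow> 'x \<Rightarrow> 'y"
    assume e: "0 < e" and D: "trig_poly D" and less: "wlim B (\<lambda>s x. \<phi> (norm (D s x))) < ennreal e"
    obtain \<eta> where \<eta>: "0 < \<eta>" "\<phi> \<eta> \<le> e"
      using True e by blast
    obtain D' where D': "trig_poly D'" "\<And>s x. x \<in> B \<Longrightarrow> D' s x = D s x" "\<exists>K. \<forall>s x. norm (D' s x) \<le> K"
      "wlim UNIV (\<lambda>s x. \<phi> (norm (D' s x))) \<le> wlim B (\<lambda>s x. \<phi> (norm (D s x))) + ennreal (\<phi> \<eta>)"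
      using trig_poly_cutoff[OF D B \<eta>(1)] by blast
    note D'(4)
    also have "wlim B (\<lambda>s x. \<phi> (norm (D s x))) + ennreal (\<phi> \<eta>) \<le> ennreal e + ennreal e"
      using less \<eta> by (intro add_mono ennreal_leI) auto
    also have "\<dots> = ennreal (2 * e)"
      using e by (simp flip: ennreal_plus)
    finally show "\<exists>D' :: real ^ 'n \<Rightarrow> 'x \<Rightarrow> 'y. controlled_extension B e D D'"
      using D' unfolding controlled_extension_def by blast
  qed simp
next
  case False
  then obtain c where c: "0 < c" "\<And>u. 0 < u \<Longrightarrow> c \<le> \<phi> u"
    by (meson less_imp_le not_le)
  have "wlim B (\<lambda>_ _. c) \<noteq> 0"
    using wlim_const_eq_0[OF c(1), of B 1] 1 by auto
  moreover have "wlim B (\<lambda>_ _. c) < top"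
    using wlim_const_le[of c B] c(1) ennreal_less_top le_less_trans less_imp_le by blast
  ultimately obtain e0 where e0: "0 < e0" "wlim B (\<lambda>_ _. c) = ennreal e0"
    by (cases "wlim B (\<lambda>_ _. c)") (auto simp: le_less)
  show ?thesis
  proof (intro exI[of _ e0] conjI allI impI e0(1))
    fix e and D :: "real ^ 'n \<Rightarrow> 'x \<Rightarrow> 'y"
    assume e: "0 < e" "e \<le> e0" and D: "trig_poly D"
      and less: "wlim B (\<lambda>s x. \<phi> (norm (D s x))) < ennreal e"
    have "wlim B (\<lambda>s x. \<phi> (norm (D s x))) < wlim B (\<lambda>_ _. c)"
      using less e unfolding e0(2) by (meson ennreal_leI less_le_trans)
    then have "D s x = 0" if "x \<in> B" for s x
      using trig_poly_rigid[OF D c(2), of B x s] c(1) that by auto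
    moreover have "wlim UNIV (\<lambda>(s :: real ^ 'n) (x :: 'x). \<phi> (norm (0 :: 'y))) = 0"
      using wlim_const_indep[OF B(2) UNIV_not_empty, of "\<phi> 0"] 0 by simp
    ultimately show "\<exists>D' :: real ^ 'n \<Rightarrow> 'x \<Rightarrow> 'y. controlled_extension B e D D'"
      unfolding controlled_extension_def using trig_poly_0 by (intro exI[of _ "\<lambda>_ _. 0"]) auto
  qed
qed

lemma luxnorm_1_finite: "luxnorm p (Lam_t \<Lambda> t) (\<lambda>_. 1) < top"
proof -
  have "\<forall>\<^sub>F t' in at_top. ennreal (\<omega> t') * luxnorm p (Lam_t \<Lambda> t') (\<lambda>_. 1) \<le> 1 \<and> 0 < t' \<and> t \<le> t'"
    using weight eventually_gt_at_top[of 0] eventually_ge_at_top[of t] by eventually_elim auto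
  then obtain t' where t': "ennreal (\<omega> t') * luxnorm p (Lam_t \<Lambda> t') (\<lambda>_. 1) \<le> 1" "0 < t'" "t \<le> t'"
    by (metis (mono_tags, lifting) eventually_happens' trivial_limit_at_top_linorder)
  have "luxnorm p (Lam_t \<Lambda> t') (\<lambda>_. 1) \<noteq> top"
    using t'(1) omega_pos[OF t'(2)] by (auto simp: ennreal_mult_top top_unique)
  moreover have "luxnorm p (Lam_t \<Lambda> t) (\<lambda>_. 1) \<le> luxnorm p (Lam_t \<Lambda> t') (\<lambda>_. 1)"
    using Lam_t_mono[OF t'(3)] by (intro luxnorm_mono_AE) auto
  ultimately show ?thesis
    by (auto simp: less_top dest: top.extremum_uniqueI)
qed

lemma eventually_omega_mult_le:
  assumes "C < top" "0 < e"
  shows "\<forall>\<^sub>F t in at_top. ennreal (\<omega> t) * C \<le> ennreal e"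
proof -
  obtain c where c: "C = ennreal c" "0 \<le> c"
    using assms(1) by (cases C) auto
  have "((\<lambda>t. \<omega> t * c) \<longlongrightarrow> 0) at_top"
    using tendsto_mult_left_zero[OF omega_tendsto] .
  then have "\<forall>\<^sub>F t in at_top. \<omega> t * c < e"
    using \<open>0 < e\<close> by (rule order_tendstoD)
  then show ?thesis
    using eventually_gt_at_top[of 0]
  proof eventually_elim
    case (elim t)
    then have "ennreal (\<omega> t) * C = ennreal (\<omega> t * c)"
      using c omega_pos[of t] by (simp add: ennreal_mult)
    also have "\<dots> \<le> ennreal e"
      using elim by (intro ennreal_leI) simp
    finally show ?case .
  qed
qed

section \<open>Completeness\<close>

text \<open>The limit equals \<open>R m\<close> on the \<open>m\<close>-th of a sequence of rapidly growing cubical shells. On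
  \<open>Lam_t \<Lambda> t\<close> only the last two shells matter: inside of them the functions differ boundedly, and
  \<open>\<omega> t\<close> is already small compared with the size of this region.\<close>

lemma glue_trig_polys:
  fixes R :: "nat \<Rightarrow> real ^ 'n \<Rightarrow> 'x::real_normed_vector \<Rightarrow> 'y::complex_normed_vector"
  assumes R: "\<And>k. trig_poly (R k)"
    and cauchy: "\<And>k m. k \<le> m \<Longrightarrow> dB UNIV (R k) (R m) < ennreal (\<delta> k)"
    and \<delta>: "\<And>k. 0 < \<delta> k"
    and bdd: "\<And>k m. \<exists>K. \<forall>s x. norm (R k s x - R m s x) \<le> K"
  shows "\<exists>G. sections_meas G \<and> (\<forall>k. dB UNIV (R k) G \<le> ennreal (3 * \<delta> k))"
proof -
  obtain Kf where Kf: "\<And>k m s x. norm (R k s x - R m s x) \<le> Kf k m"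
    using bdd by metis
  have Kf0: "0 \<le> Kf k m" for k m
    using norm_ge_zero Kf by (rule order_trans)
  define K where "K M = (\<Sum>k\<le>M. \<Sum>m\<le>M. Kf k m)" for M
  have K: "norm (R k s x - R m s x) \<le> K M" if "k \<le> M" "m \<le> M" for k m M s x
  proof -
    note Kf
    also have "Kf k m \<le> (\<Sum>m\<le>M. Kf k m)"
      using that Kf0 by (intro member_le_sum) auto
    also have "\<dots> \<le> K M"
      unfolding K_def using that Kf0
      by (intro member_le_sum[where f = "\<lambda>k. \<Sum>m\<le>M. Kf k m"]) (auto intro: sum_nonneg)
    finally show ?thesis .
  qed
  have K0: "0 \<le> K M" for M
    unfolding K_def using Kf0 by (intro sum_nonneg)
  define one where "one a = luxnorm p (Lam_t \<Lambda> a) (\<lambda>_. 1)" for a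
  define good where "good M a b \<longleftrightarrow> (\<forall>t\<ge>b. \<forall>k\<in>{..M}.
      wnorm t UNIV (gap (R k) (R M)) < ennreal (\<delta> k) \<and>
      ennreal (\<omega> t) * (ennreal (\<phi> (K M)) * one a) \<le> ennreal (\<delta> k))" for M a b
  have ex_good: "\<exists>b. good M a b \<and> a + 1 \<le> b" for M a
  proof -
    have "\<forall>\<^sub>F t in at_top. \<forall>k\<in>{..M}. wnorm t UNIV (gap (R k) (R M)) < ennreal (\<delta> k) \<and>
      ennreal (\<omega> t) * (ennreal (\<phi> (K M)) * one a) \<le> ennreal (\<delta> k)"
    proof (intro eventually_ball_finite ballI eventually_conj)
      fix k assume "k \<in> {..M}"
      then show "\<forall>\<^sub>F t in at_top. wnorm t UNIV (gap (R k) (R M)) < ennreal (\<delta> k)"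
        using cauchy[of k M] unfolding dist_B_eq_wlim wlim_def by (intro Limsup_lessD) auto
      show "\<forall>\<^sub>F t in at_top. ennreal (\<omega> t) * (ennreal (\<phi> (K M)) * one a) \<le> ennreal (\<delta> k)"
        using \<delta> luxnorm_1_finite
        by (intro eventually_omega_mult_le) (auto simp: one_def ennreal_mult_less_top)
    qed simp
    then obtain b where "good M a b"
      unfolding eventually_at_top_linorder good_def ..
    then have "good M a (max b (a + 1))"
      unfolding good_def by auto
    then show ?thesis by (intro exI[of _ "max b (a + 1)"]) simp
  qed
  have "\<exists>\<tau>. \<forall>n. True \<and> (good (Suc n) (\<tau> n) (\<tau> (Suc n)) \<and> \<tau> n + 1 \<le> \<tau> (Suc n))"
    by (rule dependent_nat_choice[of "\<lambda>_ _. True"]) (simp_all only: ex_good simp_thms)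
  then obtain \<tau> where \<tau>: "\<And>n. good (Suc n) (\<tau> n) (\<tau> (Suc n)) \<and> \<tau> n + 1 \<le> \<tau> (Suc n)"
    by blast
  have mono: "\<tau> m \<le> \<tau> n" if "m \<le> n" for m n
  proof (rule lift_Suc_mono_le[of \<tau>, OF _ that])
    show "\<tau> n \<le> \<tau> (Suc n)" for n
      using \<tau>[of n] by simp
  qed
  have lower: "\<tau> 0 + real n \<le> \<tau> n" for n
  proof (induction n)
    case (Suc n)
    then show ?case using \<tau>[of n] by simp
  qed simp
  have unbdd: "\<exists>n. c < \<tau> (Suc n)" for c
  proof -
    obtain n where "c - \<tau> 0 < real n"
      using reals_Archimedean2 by blast
    then show ?thesis
      using lower[of "Suc n"] by (intro exI[of _ n]) simp
  qed
  define box where "box a = {v :: real ^ 'n. \<forall>i. \<bar>v $ i\<bar> \<le> a}" for a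
  have box_mono: "box a \<subseteq> box b" if "a \<le> b" for a b
    using that by (auto simp: box_def intro: order_trans)
  have Lam_box: "Lam_t \<Lambda> t = \<Lambda> \<inter> box t" for t
    by (simp add: Lam_t_def box_def)
  define idx where "idx s = (LEAST m. s \<in> box (\<tau> (Suc m)))" for s
  have idx: "s \<in> box (\<tau> (Suc (idx s)))" for s
  proof -
    obtain n where n: "norm s < \<tau> (Suc n)"
      using unbdd by blast
    have "\<bar>s $ i\<bar> \<le> \<tau> (Suc n)" for i
      using component_le_norm_cart[of s i] n by simp
    then have "s \<in> box (\<tau> (Suc n))"
      unfolding box_def by blast
    then show ?thesis
      unfolding idx_def by (rule LeastI)
  qed
  have idx_le: "idx s \<le> M" if "s \<in> box (\<tau> (Suc M))" for s M
    unfolding idx_def using that by (rule Least_le)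
  define G where "G s x = R (idx s) s x" for s x
  have idx_meas: "idx \<in> measurable (restrict_space lebesgue \<Lambda>) (count_space UNIV)"
    unfolding idx_def
  proof (intro measurable_Least measurable_restrict_space1)
    fix m
    have "closed (box (\<tau> (Suc m)))"
      unfolding box_def by (rule closed_box)
    then have "box (\<tau> (Suc m)) \<in> sets lebesgue"
      by (intro sets_completionI_sets) auto
    then show "Measurable.pred lebesgue (\<lambda>s. s \<in> box (\<tau> (Suc m)))"
      by (simp add: pred_def)
  qed
  have G: "sections_meas G"
    unfolding sections_meas_def G_def
  proof
    fix x
    have "(\<lambda>s. R i s x) \<in> borel_measurable (restrict_space lebesgue \<Lambda>)" for i
      using trig_poly_sections_meas[OF R] by (simp add: sections_meas_def)
    then show "(\<lambda>s. R (idx s) s x) \<in> borel_measurable (restrict_space lebesgue \<Lambda>)"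
      by (rule measurable_compose_countable[OF _ idx_meas])
  qed
  have "dB UNIV (R k) G \<le> ennreal (3 * \<delta> k)" for k
    unfolding dist_B_eq_wlim wlim_def
  proof (rule Limsup_bounded, rule eventually_mono[OF eventually_ge_at_top])
    fix t assume t: "\<tau> (k + 2) \<le> t"
    define M where "M = (LEAST m. t < \<tau> (Suc m))"
    have M: "t < \<tau> (Suc M)"
      unfolding M_def using unbdd[of t] by (rule LeastI_ex)
    then have kM: "k + 2 \<le> M"
      using t mono[of "Suc M" "k + 2"] by linarith
    then obtain M' where M': "M = Suc M'" "1 \<le> M'" "k \<le> M'"
      by (cases M) auto
    have tM: "\<tau> M \<le> t"
      using M' not_less_Least[of M' "\<lambda>m. t < \<tau> (Suc m)"] by (simp add: M_def[symmetric])
    obtain M'' where M'': "M' = Suc M''"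
      using M'(2) by (cases M') auto
    have good1: "good M (\<tau> M') (\<tau> M)" and good2: "good M' (\<tau> M'') (\<tau> M')"
      using \<tau> unfolding M'(1) M'' by auto
    have tM': "\<tau> M' \<le> t"
      using tM mono[of M' M] M'(1) by simp
    define v where "v s (x::'x) = \<phi> (K M) * indicator (box (\<tau> M')) s" for s x
    have v_meas: "(\<lambda>s. v s x) \<in> borel_measurable (restrict_space lebesgue \<Lambda>)" for x
    proof -
      have "box (\<tau> M') \<in> sets lebesgue"
        using closed_box unfolding box_def by (intro sets_completionI_sets) auto
      then show ?thesis
        unfolding v_def by (intro measurable_restrict_space1) simp
    qed
    have v0: "0 \<le> v s x" for s x
      using K0 by (simp add: v_def phi_nonneg)
    have "wnorm t UNIV (gap (R k) G)
        \<le> wnorm t UNIV (gap (R k) (R M)) + wnorm t UNIV (\<lambda>s x. gap (R k) (R M') s x + v s x)"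
    proof (intro wnorm_add gap_measurable trig_poly_sections_meas R borel_measurable_add v_meas
        phi_nonneg norm_ge_zero add_nonneg_nonneg v0)
      fix s and x :: 'x assume s: "s \<in> Lam_t \<Lambda> t"
      have "idx s \<le> M"
        using s M box_mono[of t "\<tau> (Suc M)"] by (intro idx_le) (auto simp: Lam_box)
      then consider "idx s = M" | "idx s = M'" | "Suc (idx s) \<le> M'"
        using M' by linarith
      then show "gap (R k) G s x \<le> gap (R k) (R M) s x + (gap (R k) (R M') s x + v s x)"
      proof cases
        case 3
        have "s \<in> box (\<tau> M')"
          using idx[of s] box_mono[OF mono[OF 3]] by blast
        then have "gap (R k) G s x \<le> v s x"
          unfolding G_def v_def using M' \<open>idx s \<le> M\<close>
          by (simp add: K phi_mono)
        then show ?thesis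
          using phi_nonneg by (simp add: add_increasing)
      qed (use v0 in \<open>auto simp: G_def phi_nonneg add_increasing add_increasing2\<close>)
    qed
    also have "wnorm t UNIV (\<lambda>s x. gap (R k) (R M') s x + v s x)
        \<le> wnorm t UNIV (gap (R k) (R M')) + wnorm t UNIV v"
      by (intro wnorm_add gap_measurable trig_poly_sections_meas R v_meas
          phi_nonneg norm_ge_zero add_nonneg_nonneg v0 order_refl)
    also have "wnorm t UNIV v \<le> ennreal (\<omega> t) * (ennreal (\<phi> (K M)) * one (\<tau> M'))"
    proof (rule wnorm_le_luxnorm)
      fix x :: 'x
      have "luxnorm p (Lam_t \<Lambda> t) (\<lambda>s. v s x) = luxnorm p (Lam_t \<Lambda> t \<inter> box (\<tau> M')) (\<lambda>_. \<phi> (K M))"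
        unfolding v_def by (rule luxnorm_indicator)
      also have "\<dots> \<le> luxnorm p (Lam_t \<Lambda> (\<tau> M')) (\<lambda>_. \<phi> (K M))"
        using K0 by (intro luxnorm_mono_AE) (auto simp: Lam_box phi_nonneg)
      also have "\<dots> \<le> ennreal (\<phi> (K M)) * one (\<tau> M')"
        unfolding one_def using K0 by (intro luxnorm_const_le phi_nonneg)
      finally show "luxnorm p (Lam_t \<Lambda> t) (\<lambda>s. v s x) \<le> ennreal (\<phi> (K M)) * one (\<tau> M')" .
    qed
    also have "wnorm t UNIV (gap (R k) (R M)) + (wnorm t UNIV (gap (R k) (R M'))
        + ennreal (\<omega> t) * (ennreal (\<phi> (K M)) * one (\<tau> M'))) \<le> ennreal (\<delta> k) + (ennreal (\<delta> k) + ennreal (\<delta> k))"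
      using good1 good2 tM tM' M' unfolding good_def by (intro add_mono) (auto intro: less_imp_le)
    also have "\<dots> = ennreal (3 * \<delta> k)"
      using \<delta>[of k] by (simp flip: ennreal_plus)
    finally show "wnorm t UNIV (gap (R k) G) \<le> ennreal (3 * \<delta> k)"
      by (simp add: add_left_mono)
  qed
  with G show ?thesis by blast
qed

lemma dist_B_cong:
  assumes "\<And>s x. x \<in> B \<Longrightarrow> F s x = F' s x" "\<And>s x. x \<in> B \<Longrightarrow> G s x = G' s x"
  shows "dB B F G = dB B F' G'"
  unfolding dist_B_def using assms by (intro Limsup_eq always_eventually) simp

lemma ex_trig_poly_Cauchy_extension:
  fixes P :: "nat \<Rightarrow> real ^ 'n \<Rightarrow> 'x::real_normed_vector \<Rightarrow> 'y::complex_normed_vector"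
  assumes P: "\<And>k. trig_poly (P k)"
    and less: "\<And>k. dB B (P k) (P (Suc k)) < ennreal (e0 / 2 ^ k)"
    and ext: "\<forall>e D. 0 < e \<longrightarrow> e \<le> e0 \<longrightarrow> trig_poly D \<longrightarrow> wlim B (\<lambda>s x. \<phi> (norm (D s x))) < ennreal e \<longrightarrow>
      (\<exists>D' :: real ^ 'n \<Rightarrow> 'x \<Rightarrow> 'y. controlled_extension B e D D')"
    and e0: "0 < e0" and 0: "wlim (UNIV :: 'x set) (\<lambda>_ _. \<phi> 0) = 0"
  shows "\<exists>R. (\<forall>k. trig_poly (R k)) \<and> (\<forall>k s. \<forall>x\<in>B. R k s x = P k s x) \<and>
    (\<forall>k m. k \<le> m \<longrightarrow> dB UNIV (R k) (R m) < ennreal (4 * e0 / 2 ^ k)) \<and>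
    (\<forall>k m. \<exists>K. \<forall>s x. norm (R k s x - R m s x) \<le> K)"
proof -
  have "\<exists>D' :: real ^ 'n \<Rightarrow> 'x \<Rightarrow> 'y.
      controlled_extension B (e0 / 2 ^ k) (\<lambda>s x. P (Suc k) s x - P k s x) D'" for k
  proof (rule ext[rule_format])
    show "e0 / 2 ^ k \<le> e0"
      using e0 by (simp add: divide_le_eq)
    show "wlim B (\<lambda>s x. \<phi> (norm (P (Suc k) s x - P k s x))) < ennreal (e0 / 2 ^ k)"
      using less[of k] unfolding dist_B_commute[of B "P k"] by (simp add: dist_B_eq_wlim)
  qed (use e0 P in \<open>auto intro: trig_poly_diff\<close>)
  then obtain D :: "nat \<Rightarrow> real ^ 'n \<Rightarrow> 'x \<Rightarrow> 'y"
    where "\<And>k. controlled_extension B (e0 / 2 ^ k) (\<lambda>s x. P (Suc k) s x - P k s x) (D k)"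
    by metis
  then have D: "\<And>k. trig_poly (D k)" "\<And>k s x. x \<in> B \<Longrightarrow> D k s x = P (Suc k) s x - P k s x"
      "\<And>k. \<exists>K. \<forall>s x. norm (D k s x) \<le> K"
      "\<And>k. wlim UNIV (\<lambda>s x. \<phi> (norm (D k s x))) \<le> ennreal (2 * (e0 / 2 ^ k))"
    unfolding controlled_extension_def by blast+
  obtain K where K: "\<And>k s x. norm (D k s x) \<le> K k"
    using D(3) by metis
  define R where "R k s x = P 0 s x + (\<Sum>j<k. D j s x)" for k s x
  have R: "trig_poly (R k)" for k
    unfolding R_def using P D by (intro trig_poly_add trig_poly_sum) auto
  have step: "R (Suc k) s x - R k s x = D k s x" for k s x
    by (simp add: R_def)
  have diff: "R m s x - R k s x = (\<Sum>j=k..<m. D j s x)" if "k \<le> m" for k m s x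
    using that by (induction m rule: dec_induct) (simp_all add: R_def)
  have le: "dB UNIV (R k) (R m) \<le> ennreal (4 * e0 / 2 ^ k - 4 * e0 / 2 ^ m)" if "k \<le> m" for k m
    using that
  proof (induction m rule: dec_induct)
    case base
    then show ?case using 0 by (simp add: dist_B_eq_wlim)
  next
    case (step m)
    have "dB UNIV (R k) (R (Suc m)) \<le> dB UNIV (R k) (R m) + dB UNIV (R (Suc m)) (R m)"
      by (intro dist_B_triangle_trig_mid trig_poly_sections_meas R)
    also have "dB UNIV (R (Suc m)) (R m) \<le> ennreal (2 * (e0 / 2 ^ m))"
      using D(4) by (simp add: dist_B_eq_wlim \<open>\<And>k s x. R (Suc k) s x - R k s x = D k s x\<close>)
    also have "dB UNIV (R k) (R m) + ennreal (2 * (e0 / 2 ^ m))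
        \<le> ennreal (4 * e0 / 2 ^ k - 4 * e0 / 2 ^ m) + ennreal (2 * (e0 / 2 ^ m))"
      using step.IH by (rule add_right_mono)
    also have "\<dots> = ennreal (4 * e0 / 2 ^ k - 4 * e0 / 2 ^ m + 2 * (e0 / 2 ^ m))"
      using e0 step.hyps by (intro ennreal_plus[symmetric]) (auto simp: frac_le)
    also have "4 * e0 / 2 ^ k - 4 * e0 / 2 ^ m + 2 * (e0 / 2 ^ m) = 4 * e0 / 2 ^ k - 4 * e0 / 2 ^ Suc m"
      by simp
    finally show ?case by (simp add: add_left_mono)
  qed
  show ?thesis
  proof (intro exI[of _ R] conjI allI impI ballI)
    show "trig_poly (R k)" for k by (rule R)
    show "R k s x = P k s x" if "x \<in> B" for k s x
      using sum_lessThan_telescope[of "\<lambda>j. P j s x" k] by (simp add: R_def D(2)[OF that])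
    show "dB UNIV (R k) (R m) < ennreal (4 * e0 / 2 ^ k)" if "k \<le> m" for k m
      using le[OF that] by (rule le_less_trans) (use e0 in \<open>auto intro!: ennreal_lessI\<close>)
    show "\<exists>K. \<forall>s x. norm (R k s x - R m s x) \<le> K" for k m
    proof (intro exI allI)
      fix s x
      have "norm (R k s x - R m s x) = norm (\<Sum>j=min k m..<max k m. D j s x)"
        using diff[of k m s x] diff[of m k s x] norm_minus_commute[of "R k s x" "R m s x"]
        by (cases "k \<le> m") (simp_all add: min_def max_def)
      also have "\<dots> \<le> (\<Sum>j=min k m..<max k m. K j)"
        using K by (rule sum_norm_le)
      finally show "norm (R k s x - R m s x) \<le> (\<Sum>j=min k m..<max k m. K j)" .
    qed
  qed
qed

lemma ex_dist_B_limit: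
  fixes f :: "nat \<Rightarrow> real ^ 'n \<Rightarrow> 'x::real_normed_vector \<Rightarrow> 'y::complex_normed_vector"
  assumes B: "bounded B" "B \<noteq> {}" and 1: "wlim B (\<lambda>_ _. 1) \<noteq> 0"
    and f: "\<And>k. approximable B (f k)"
    and cauchy: "\<And>e. 0 < e \<Longrightarrow> \<exists>N. \<forall>m\<ge>N. \<forall>n\<ge>N. dB B (f m) (f n) < ennreal e"
  obtains G where "approximable UNIV G" "(\<lambda>k. dB B (f k) G) \<longlonglongrightarrow> 0"
proof -
  have 0: "wlim B (\<lambda>_ _. \<phi> 0) = 0"
    using f by (rule wlim_phi_0)
  obtain e0 :: real where e0: "0 < e0"
    and ext: "\<forall>e D. 0 < e \<longrightarrow> e \<le> e0 \<longrightarrow> trig_poly D \<longrightarrow> wlim B (\<lambda>s x. \<phi> (norm (D s x))) < ennreal e \<longrightarrow>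
      (\<exists>D' :: real ^ 'n \<Rightarrow> 'x \<Rightarrow> 'y. controlled_extension B e D D')"
    using trig_poly_extension[OF B 1 0] by blast
  define e where "e k = e0 / 4 / 2 ^ k" for k :: nat
  have e: "0 < e k" "e (Suc k) \<le> e k" for k
    using e0 by (simp_all add: e_def field_simps)
  have "\<exists>N. \<forall>k. \<forall>m\<ge>N k. \<forall>n\<ge>N k. dB B (f m) (f n) < ennreal (e k)"
    by (rule choice) (rule allI, rule cauchy[OF e(1)])
  then obtain N where N: "\<And>k m n. N k \<le> m \<Longrightarrow> N k \<le> n \<Longrightarrow> dB B (f m) (f n) < ennreal (e k)"
    by blast
  define N' where "N' k = (\<Sum>j\<le>k. N j)" for k
  have N': "N k \<le> N' k" "N' k \<le> N' (Suc k)" for k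
    by (auto simp: N'_def intro: member_le_sum)
  have "\<exists>P. trig_poly P \<and> dB B (f (N' k)) P < ennreal (e k)" for k
    using approximableE[OF f, of "ennreal (e k)"] e(1)[of k] by (metis ennreal_less_zero_iff)
  then obtain P where P: "\<And>k. trig_poly (P k)" "\<And>k. dB B (f (N' k)) (P k) < ennreal (e k)"
    by metis
  have meas: "sections_meas (f k)" "sections_meas (P k)" for k
    using f P by (auto simp: approximable_def intro: trig_poly_sections_meas)
  have step: "dB B (P k) (P (Suc k)) < ennreal (e0 / 2 ^ k)" for k
  proof -
    have "dB B (P k) (P (Suc k)) \<le> dB B (P k) (f (N' k)) + dB B (f (N' k)) (P (Suc k))"
      using meas f by (intro dist_B_triangle)
    also have "\<dots> \<le> dB B (P k) (f (N' k)) +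
        (dB B (f (N' k)) (f (N' (Suc k))) + dB B (f (N' (Suc k))) (P (Suc k)))"
      using meas f by (intro add_left_mono dist_B_triangle)
    also have "\<dots> \<le> ennreal (e k) + (ennreal (e k) + ennreal (e k))"
    proof (intro add_mono less_imp_le)
      show "dB B (P k) (f (N' k)) < ennreal (e k)"
        using P(2) by (simp add: dist_B_commute)
      show "dB B (f (N' k)) (f (N' (Suc k))) < ennreal (e k)"
        using N'(1)[of k] N'(2)[of k] by (intro N) linarith+
      show "dB B (f (N' (Suc k))) (P (Suc k)) < ennreal (e k)"
        using P(2) ennreal_leI[OF e(2)] by (rule less_le_trans)
    qed
    also have "\<dots> = ennreal (3 * e k)"
      using e(1)[of k] by (simp flip: ennreal_plus)
    also have "\<dots> < ennreal (e0 / 2 ^ k)"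
      using e0 by (simp add: e_def ennreal_less_iff field_simps)
    finally show ?thesis .
  qed
  have "wlim (UNIV :: 'x set) (\<lambda>_ _. \<phi> 0) = 0"
    using 0 wlim_const_indep[OF B(2) UNIV_not_empty, of "\<phi> 0"] by simp
  from ex_trig_poly_Cauchy_extension[OF P(1) step ext e0 this]
  obtain R where R': "\<forall>k. trig_poly (R k)" "\<forall>k s. \<forall>x\<in>B. R k s x = P k s x"
      "\<forall>k m. k \<le> m \<longrightarrow> dB UNIV (R k) (R m) < ennreal (4 * e0 / 2 ^ k)"
      "\<forall>k m. \<exists>K. \<forall>s x. norm (R k s x - R m s x) \<le> K"
    by (elim exE conjE) (rule that)
  note R = R'(1,2)[rule_format] and RC = R'(3)[rule_format] and Rb = R'(4)[rule_format]
  have pos: "0 < 4 * e0 / 2 ^ k" for k :: nat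
    using e0 by simp
  have "\<exists>G. sections_meas G \<and> (\<forall>k. dB UNIV (R k) G \<le> ennreal (3 * (4 * e0 / 2 ^ k)))"
    by (intro glue_trig_polys R(1) RC pos Rb)
  then obtain G where G': "sections_meas G" "\<forall>k. dB UNIV (R k) G \<le> ennreal (3 * (4 * e0 / 2 ^ k))"
    by (elim exE conjE) (rule that)
  note G = G'(1) G'(2)[rule_format]
  have small: "\<exists>k. c * e0 / 2 ^ k < r" if "0 < r" for c r
  proof -
    obtain k where "c * e0 / r < 2 ^ k"
      using real_arch_pow[of 2 "c * e0 / r"] by auto
    then show ?thesis
      using that by (intro exI[of _ k]) (simp add: field_simps)
  qed
  show ?thesis
  proof (rule that)
    have "(\<lambda>k. dB UNIV G (R k)) \<longlonglongrightarrow> 0"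
    proof (rule tendsto_zero_ennreal)
      fix r :: real assume "0 < r"
      then obtain k0 where k0: "12 * e0 / 2 ^ k0 < r"
        using small by blast
      show "\<forall>\<^sub>F k in sequentially. dB UNIV G (R k) < ennreal r"
        using eventually_ge_at_top[of k0]
      proof eventually_elim
        case (elim k)
        have "dB UNIV G (R k) \<le> ennreal (12 * e0 / 2 ^ k)"
          using G(2)[of k] by (simp add: dist_B_commute)
        also have "\<dots> \<le> ennreal (12 * e0 / 2 ^ k0)"
          using e0 elim by (intro ennreal_leI divide_left_mono power_increasing) auto
        also have "\<dots> < ennreal r"
          using k0 e0 by (simp add: ennreal_less_iff)
        finally show ?case .
      qed
    qed
    then show "approximable UNIV G"
      unfolding approximable_def using G(1) R(1) by blast
    show "(\<lambda>k. dB B (f k) G) \<longlonglongrightarrow> 0"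
    proof (rule tendsto_zero_ennreal)
      fix r :: real assume "0 < r"
      then obtain k where k: "13 * e0 / 2 ^ k < r"
        using small by blast
      show "\<forall>\<^sub>F n in sequentially. dB B (f n) G < ennreal r"
        using eventually_ge_at_top[of "N k"]
      proof eventually_elim
        case (elim n)
        have "dB B (f n) G \<le> dB B (f n) (f (N' k)) + dB B (f (N' k)) G"
          using meas G f by (intro dist_B_triangle)
        also have "\<dots> \<le> dB B (f n) (f (N' k)) + (dB B (f (N' k)) (P k) + dB B G (P k))"
          using meas G P by (intro add_left_mono dist_B_triangle_trig_mid)
        also have "dB B G (P k) = dB B (R k) G"
          unfolding dist_B_commute[of B G] using R(2) by (intro dist_B_cong) auto
        also have "\<dots> \<le> ennreal (3 * (4 * e0 / 2 ^ k))"
          using dist_B_mono G(2) by (rule order_trans) simp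
        also have "dB B (f n) (f (N' k)) + (dB B (f (N' k)) (P k) + ennreal (3 * (4 * e0 / 2 ^ k)))
            \<le> ennreal (e k) + (ennreal (e k) + ennreal (3 * (4 * e0 / 2 ^ k)))"
          using N[OF elim N'(1)] P(2)[of k] by (intro add_mono order_refl less_imp_le)
        also have "\<dots> = ennreal (e k + (e k + 3 * (4 * e0 / 2 ^ k)))"
          using e(1)[of k] e0 by (simp flip: ennreal_plus)
        also have "\<dots> \<le> ennreal (13 * e0 / 2 ^ k)"
          using e0 by (intro ennreal_leI) (simp add: e_def field_simps)
        also have "\<dots> < ennreal r"
          using k e0 by (simp add: ennreal_less_iff)
        finally show ?case by (simp add: add_left_mono)
      qed
    qed
  qed
qed

lemma approximable_mono:
  assumes "approximable B F" "B' \<subseteq> B"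
  shows "approximable B' F"
proof -
  obtain P where "\<And>k. trig_poly (P k)" and lim: "(\<lambda>k. dB B F (P k)) \<longlonglongrightarrow> 0"
    using assms(1) by (auto simp: approximable_def)
  moreover have "(\<lambda>k. dB B' F (P k)) \<longlonglongrightarrow> 0"
    by (rule tendsto_sandwich[OF _ _ tendsto_const lim]) (auto intro!: always_eventually dist_B_mono assms(2))
  ultimately show ?thesis
    using assms(1) by (auto simp: approximable_def)
qed

lemma pseudometric_on_e_Besicovitch:
  assumes "B \<in> \<B>" "bounded B"
  shows "pseudometric_on (e_Besicovitch \<B> \<phi> \<omega> p \<Lambda>) (dB B)"
proof -
  have "approximable B F" if "F \<in> e_Besicovitch \<B> \<phi> \<omega> p \<Lambda>" for F
    using that assms(1) e_Besicovitch_iff[of \<B> F] by auto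
  then show ?thesis
    unfolding pseudometric_on_def using assms(2)
    by (auto intro: dist_B_finite dist_B_self dist_B_commute dist_B_triangle approximable_sections_meas)
qed

lemma complete_pseudometric_on_e_Besicovitch:
  fixes B :: "'x::real_normed_vector set"
  assumes "B \<in> \<B>" "bounded B" "B \<noteq> {}"
  shows "complete_pseudometric_on
    (e_Besicovitch \<B> \<phi> \<omega> p \<Lambda> :: (real ^ 'n \<Rightarrow> 'x \<Rightarrow> 'y::complex_normed_vector) set) (dB B)"
  unfolding complete_pseudometric_on_def
proof (intro allI impI)
  fix f :: "nat \<Rightarrow> real ^ 'n \<Rightarrow> 'x \<Rightarrow> 'y"
  assume f: "\<forall>k. f k \<in> e_Besicovitch \<B> \<phi> \<omega> p \<Lambda>"
    and cauchy: "\<forall>e>0. \<exists>N. \<forall>m\<ge>N. \<forall>n\<ge>N. dB B (f m) (f n) < ennreal e"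
  have iff: "F \<in> e_Besicovitch \<B> \<phi> \<omega> p \<Lambda> \<longleftrightarrow> (\<forall>B\<in>\<B>. approximable B F)"
    for F :: "real ^ 'n \<Rightarrow> 'x \<Rightarrow> 'y"
    using assms(1) by (intro e_Besicovitch_iff) auto
  have fB: "approximable B (f k)" for k
    using f assms(1) by (simp add: iff)
  show "\<exists>g\<in>e_Besicovitch \<B> \<phi> \<omega> p \<Lambda>. (\<lambda>k. dB B (f k) g) \<longlonglongrightarrow> 0"
  proof (cases "wlim B (\<lambda>_ _. 1) = 0")
    case True
    then have "dB B (f k) (f 0) = 0" for k
      using fB assms(2) by (intro dist_B_eq_0_if_wlim_1_eq_0)
    then show ?thesis
      using f by (intro bexI[of _ "f 0"]) auto
  next
    case False
    obtain G where G: "approximable UNIV G" "(\<lambda>k. dB B (f k) G) \<longlonglongrightarrow> 0"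
      using ex_dist_B_limit[OF assms(2,3) False fB cauchy[rule_format]] .
    have "G \<in> e_Besicovitch \<B> \<phi> \<omega> p \<Lambda>"
      unfolding iff using approximable_mono[OF G(1)] by simp
    with G(2) show ?thesis by (rule bexI)
  qed
qed

end

lemma mult_le_1_if_le_inverse:
  fixes a b :: ennreal
  assumes "a \<le> inverse b"
  shows "a * b \<le> 1"
proof (cases "b = 0 \<or> b = top")
  case True
  then show ?thesis using assms by auto
next
  case False
  have "a * b \<le> inverse b * b"
    using assms by (rule mult_right_mono) simp
  also have "\<dots> = 1"
    using False by (cases b) (auto simp: inverse_ennreal ennreal_mult[symmetric] le_less)
  finally show ?thesis .
qed

theorem theorem2p4:
  fixes \<B> :: "('x::{complex_normed_vector,banach}) set set"
    and \<Lambda> :: "(real ^ 'n) set"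
    and p :: "real ^ 'n \<Rightarrow> ennreal"
    and \<omega> :: "real \<Rightarrow> real"
    and \<phi> :: "real \<Rightarrow> real"
  assumes B_nonempty: "\<B> \<noteq> {}"
    and B_elems: "\<forall>B\<in>\<B>. B \<noteq> {}"
    and B_cover: "\<Union>\<B> = UNIV"
    and B_bounded: "\<forall>B\<in>\<B>. bounded B"
    and Lam_meas: "\<Lambda> \<in> sets lebesgue"
    and Lam_ne: "\<Lambda> \<noteq> {}"
    and Lam_unbdd: "\<not> bounded \<Lambda>"
    and p_meas: "p \<in> borel_measurable (restrict_space lebesgue \<Lambda>)"
    and p_ge1: "\<forall>x\<in>\<Lambda>. 1 \<le> p x"
    and omega_pos: "\<forall>t>0. \<omega> t > 0"
    and phi_nonneg: "\<forall>u\<ge>0. \<phi> u \<ge> 0"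
    and phi_mono: "mono_on {0..} \<phi>"
    and phi_subadd: "\<forall>u\<ge>0. \<forall>v\<ge>0. \<phi> (u + v) \<le> \<phi> u + \<phi> v"
    and omega_limsup: "Limsup at_top (\<lambda>t. ereal (\<omega> t)) = 0"
    and omega_bound: "\<exists>t0>0. \<forall>t\<ge>t0.
        ennreal (\<omega> t) \<le> inverse (luxnorm p (Lam_t \<Lambda> t) (\<lambda>_. 1))"
  shows "\<forall>B\<in>\<B>.
      pseudometric_on (e_Besicovitch \<B> \<phi> \<omega> p \<Lambda> :: (real ^ 'n \<Rightarrow> 'x \<Rightarrow> 'y::{complex_normed_vector,banach}) set)
        (dist_B \<phi> \<omega> p \<Lambda> B) \<and>
      complete_pseudometric_on (e_Besicovitch \<B> \<phi> \<omega> p \<Lambda> :: (real ^ 'n \<Rightarrow> 'x \<Rightarrow> 'y) set)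
        (dist_B \<phi> \<omega> p \<Lambda> B)"
proof -
  interpret weighted_luxemburg \<Lambda> p \<omega> \<phi>
  proof
    show "(\<omega> \<longlongrightarrow> 0) at_top"
    proof (rule order_tendstoI)
      fix a :: real assume "a < 0"
      show "\<forall>\<^sub>F t in at_top. a < \<omega> t"
        using eventually_gt_at_top[of 0]
        by eventually_elim (use omega_pos \<open>a < 0\<close> in force)
    next
      fix a :: real assume "0 < a"
      then have "Limsup at_top (\<lambda>t. ereal (\<omega> t)) < ereal a"
        using omega_limsup by simp
      from Limsup_lessD[OF this] show "\<forall>\<^sub>F t in at_top. \<omega> t < a"
        by simp
    qed
    obtain t0 where "\<And>t. t0 \<le> t \<Longrightarrow> ennreal (\<omega> t) \<le> inverse (luxnorm p (Lam_t \<Lambda> t) (\<lambda>_. 1))"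
      using omega_bound by blast
    then show "\<forall>\<^sub>F t in at_top. ennreal (\<omega> t) * luxnorm p (Lam_t \<Lambda> t) (\<lambda>_. 1) \<le> 1"
      unfolding eventually_at_top_linorder by (intro exI[of _ t0] allI impI mult_le_1_if_le_inverse)
    show "\<phi> u \<le> \<phi> v" if "0 \<le> u" "u \<le> v" for u v
      using phi_mono that by (auto simp: mono_on_def)
  qed (use Lam_meas p_meas p_ge1 omega_pos phi_nonneg phi_subadd in auto)
  show ?thesis
    using B_elems B_bounded
    by (auto intro: pseudometric_on_e_Besicovitch complete_pseudometric_on_e_Besicovitch)
qed

end
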